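(* The functional $S:\mathcal M_{\rm ac}\to\mathbb R$ is bounded, convex and lower semicontinuous. Moreover, $S_0(\gamma)=\mathcal G(\gamma,F(\gamma))$ for every $\gamma\in\mathcal M_{\rm ac}$, where $F(\gamma)$ is the solution in $\mathcal F$ of the boundary value problem $$\Delta F=(\gamma-F)\frac{(\nabla F)^2}{F(1-F)}\ \text{ in }(0,1),\qquad \nabla F(0)=A^{-1}[F(0)-\alpha],\qquad \nabla F(1)=B^{-1}[\beta-F(1)].$$
   Context: Fix $0<\alpha<\beta<1$, $A>0$, $B>0$. $\nabla$ and $\Delta$ denote the first and second derivatives in the space variable $x\in[0,1]$. $\mathcal M$ is the set of non-negative measures on $[0,1]$ with total mass at most $1$, with the weak topology. $\mathcal M_{\rm ac}\subset\mathcal M$ is the subset (with the induced topology) of measures $\gamma(x)\,dx$ with density satisfying $0\le\gamma\le1$; the measure is identified with its density $\gamma$. $\mathcal F=\{F\in C^1([0,1]):\ \alpha<F(x)<\beta,\ \nabla F(x)>0\ \ \forall x\in[0,1]\}$. For $\gamma\in\mathcal M_{\rm ac}$, $F\in\mathcal F$ (convention $0\log0=0$), $$\mathcal G(\gamma,F)=\int_0^1\Big\{\gamma\log\frac{\gamma}{F}+(1-\gamma)\log\frac{1-\gamma}{1-F}+\log\frac{\nabla F}{\beta-\alpha}\Big\}dx+A\log\frac{F(0)-\alpha}{A(\beta-\alpha)}+B\log\frac{\beta-F(1)}{B(\beta-\alpha)}.$$ $S_0(\gamma)=\sup_{F\in\mathcal F}\mathcal G(\gamma,F)$ and $S(\gamma)=S_0(\gamma)-S_0(\bar\rho)$,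 where $$\bar\rho(x)=\frac{\alpha(1+B)+\beta A}{1+A+B}+\frac{(\beta-\alpha)x}{1+A+B}.$$ Meaning of the boundary value problem: $F\in\mathcal F$ is a solution if it solves the integro-differential equation $$F(x)=\alpha+(\beta-\alpha)\frac{A+\int_0^x\exp\{\int_0^y\mathcal R_\gamma(F;z)dz\}dy}{A+\int_0^1\exp\{\int_0^y\mathcal R_\gamma(F;z)dz\}dy+B\exp\{\int_0^1\mathcal R_\gamma(F;y)dy\}},\quad \mathcal R_\gamma(F;x)=[\gamma(x)-F(x)]\frac{\nabla F(x)}{F(x)[1-F(x)]}$$ (then the boundary conditions hold and the differential equation holds almost everywhere). For each $\gamma\in\mathcal M_{\rm ac}$ there is a unique such $F\in\mathcal F$, denoted $F(\gamma)$. *)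

theory Defs
  imports "HOL-Analysis.Analysis"
begin

definition unit_measures :: "real measure set"  where
  "unit_measures = {\<mu>. sets \<mu> = sets (restrict_space borel {0..1}) \<and> emeasure \<mu> (space \<mu>) \<le> 1}"

text \<open>The weak topology: the coarsest topology on the set of measures that makes
  integration against each continuous function on [0,1] continuous.\<close>

definition weak_topology :: "real measure topology"  where
  "weak_topology = topology_generated_by
     {{\<mu> \<in> unit_measures. (\<integral>x. f x \<partial>\<mu>) \<in> U} | f U.
        continuous_on {0..1} (f :: real \<Rightarrow> real) \<and> open (U :: real set)}"

text \<open>Absolutely continuous measures are represented by their densities, which are honest functions;
  their values outside [0,1] are irrelevant.  The topology on densities is the one induced by the
  weak topology through the map sending a density to its measure.  Versions of a density
  that agree almost everywhere on [0,1] are topologically indistinguishable, so that for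
  functionals of densities lower semicontinuity means that they factor through the
  measure and are lower semicontinuous there.\<close>

definition density_measure :: "(real \<Rightarrow> real) \<Rightarrow> real measure"  where
  "density_measure \<gamma> = density (restrict_space lborel {0..1}) (\<lambda>x. ennreal (\<gamma> x))"

definition M_ac :: "(real \<Rightarrow> real) set"  where
  "M_ac = {\<gamma> \<in> borel_measurable (restrict_space borel {0..1}). \<forall>x\<in>{0..1}. 0 \<le> \<gamma> x \<and> \<gamma> x \<le> 1}"

definition M_ac_topology :: "(real \<Rightarrow> real) topology"  where
  "M_ac_topology = pullback_topology M_ac density_measure weak_topology"

definition lower_semicontinuous_map :: "'a topology \<Rightarrow> ('a \<Rightarrow> ereal) \<Rightarrow> bool"  where
  "lower_semicontinuous_map X f \<longleftrightarrow> (\<forall>a. openin X {x \<in> topspace X. a < f x})"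

text \<open>The derivative on [0,1], one-sided at the two endpoints.\<close>

definition nabla :: "(real \<Rightarrow> real) \<Rightarrow> real \<Rightarrow> real"  where
  "nabla F x = vector_derivative F (at x within {0..1})"

text \<open>Functions on [0,1] are taken extensional, so that equality in this set is equality on [0,1].\<close>

definition F_set :: "real \<Rightarrow> real \<Rightarrow> (real \<Rightarrow> real) set"  where
  "F_set \<alpha> \<beta> = {F \<in> extensional {0..1}.
     F differentiable_on {0..1} \<and> continuous_on {0..1} (nabla F) \<and>
     (\<forall>x\<in>{0..1}. \<alpha> < F x \<and> F x < \<beta> \<and> nabla F x > 0)}"

text \<open>The convention \<open>0 * log 0 = 0\<close> holds automatically, since \<open>ln 0\<close> is a real number.\<close>

definition G_fun ::
  "real \<Rightarrow> real \<Rightarrow> real \<Rightarrow> real \<Rightarrow> (real \<Rightarrow> real) \<Rightarrow> (real \<Rightarrow> real) \<Rightarrow> real"  where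
  "G_fun \<alpha> \<beta> A B \<gamma> F =
     (LINT x:{0..1}|lborel. \<gamma> x * ln (\<gamma> x / F x)
        + (1 - \<gamma> x) * ln ((1 - \<gamma> x) / (1 - F x))
        + ln (nabla F x / (\<beta> - \<alpha>)))
     + A * ln ((F 0 - \<alpha>) / (A * (\<beta> - \<alpha>)))
     + B * ln ((\<beta> - F 1) / (B * (\<beta> - \<alpha>)))"

text \<open>The supremum is taken in the extended reals; its finiteness is not built in.\<close>

definition S0 :: "real \<Rightarrow> real \<Rightarrow> real \<Rightarrow> real \<Rightarrow> (real \<Rightarrow> real) \<Rightarrow> ereal"  where
  "S0 \<alpha> \<beta> A B \<gamma> = (SUP F\<in>F_set \<alpha> \<beta>. ereal (G_fun \<alpha> \<beta> A B \<gamma> F))"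

definition rho_bar :: "real \<Rightarrow> real \<Rightarrow> real \<Rightarrow> real \<Rightarrow> real \<Rightarrow> real"  where
  "rho_bar \<alpha> \<beta> A B x =
     (\<alpha> * (1 + B) + \<beta> * A) / (1 + A + B) + (\<beta> - \<alpha>) * x / (1 + A + B)"

definition S_fun :: "real \<Rightarrow> real \<Rightarrow> real \<Rightarrow> real \<Rightarrow> (real \<Rightarrow> real) \<Rightarrow> ereal"  where
  "S_fun \<alpha> \<beta> A B \<gamma> = S0 \<alpha> \<beta> A B \<gamma> - S0 \<alpha> \<beta> A B (rho_bar \<alpha> \<beta> A B)"

definition R_fun :: "(real \<Rightarrow> real) \<Rightarrow> (real \<Rightarrow> real) \<Rightarrow> real \<Rightarrow> real"  where
  "R_fun \<gamma> F x = (\<gamma> x - F x) * (nabla F x / (F x * (1 - F x)))"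

text \<open>The integro-differential form of the boundary value problem
  \<open>F'' = (\<gamma> - F) (F')^2 / (F (1 - F))\<close>, \<open>F'(0) = (F(0) - \<alpha>) / A\<close>, \<open>F'(1) = (\<beta> - F(1)) / B\<close>.\<close>

definition solves_bvp ::
  "real \<Rightarrow> real \<Rightarrow> real \<Rightarrow> real \<Rightarrow> (real \<Rightarrow> real) \<Rightarrow> (real \<Rightarrow> real) \<Rightarrow> bool"  where
  "solves_bvp \<alpha> \<beta> A B \<gamma> F \<longleftrightarrow> F \<in> F_set \<alpha> \<beta> \<and>
     (\<forall>x\<in>{0..1}. F x = \<alpha> + (\<beta> - \<alpha>) *
        ((A + (LINT y:{0..x}|lborel. exp (LINT z:{0..y}|lborel. R_fun \<gamma> F z)))
         / (A + (LINT y:{0..1}|lborel. exp (LINT z:{0..y}|lborel. R_fun \<gamma> F z))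
              + B * exp (LINT y:{0..1}|lborel. R_fun \<gamma> F y))))"

definition F_sol :: "real \<Rightarrow> real \<Rightarrow> real \<Rightarrow> real \<Rightarrow> (real \<Rightarrow> real) \<Rightarrow> real \<Rightarrow> real"  where
  "F_sol \<alpha> \<beta> A B \<gamma> = (THE F. solves_bvp \<alpha> \<beta> A B \<gamma> F)"

lemma topspace_weak_topology: "topspace weak_topology = unit_measures"
proof -
  have "unit_measures \<in> {{\<mu> \<in> unit_measures. (\<integral>x. f x \<partial>\<mu>) \<in> U} | f U.
        continuous_on {0..1} (f :: real \<Rightarrow> real) \<and> open (U :: real set)}"
    by (intro CollectI exI[of _ "\<lambda>_. 0"] exI[of _ UNIV]) auto
  then show ?thesis
    unfolding weak_topology_def topology_generated_by_topspace by blast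
qed

lemma density_measure_in_unit_measures:
  assumes "\<gamma> \<in> M_ac"
  shows "density_measure \<gamma> \<in> unit_measures"
proof -
  let ?L = "restrict_space lborel {0..1::real}"
  have sets: "sets ?L = sets (restrict_space borel {0..1})"
    by (simp add: sets_restrict_space)
  have meas: "\<gamma> \<in> borel_measurable ?L"
    using assms measurable_cong_sets[OF sets refl] by (auto simp: M_ac_def)
  have "emeasure (density_measure \<gamma>) (space ?L)
      = (\<integral>\<^sup>+ x. ennreal (\<gamma> x) * indicator (space ?L) x \<partial>?L)"
    unfolding density_measure_def using meas by (intro emeasure_density sets.top) auto
  also have "\<dots> \<le> (\<integral>\<^sup>+ x. 1 \<partial>?L)"
    using assms by (intro nn_integral_mono)
      (auto simp: M_ac_def space_restrict_space indicator_def ennreal_le_1)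
  also have "\<dots> = 1"
    by (simp add: emeasure_restrict_space space_restrict_space)
  finally show ?thesis
    using sets by (simp add: unit_measures_def density_measure_def)
qed

lemma topspace_M_ac_topology: "topspace M_ac_topology = M_ac"
  using density_measure_in_unit_measures
  by (auto simp: M_ac_topology_def topspace_pullback_topology topspace_weak_topology)

end

theory Submission
  imports Defs
begin

text \<open>In the variable \<open>\<phi> = ln (F / (1 - F))\<close> the functional \<open>F \<mapsto> G(\<gamma>, F)\<close> is strictly concave, and
  the boundary value problem is its Euler-Lagrange equation \<open>(1 / \<phi>')' = 1 - \<gamma> - F\<close> with
  natural boundary conditions.  Hence a solution is a maximiser, and it is unique; quantitatively,
  the defect dominates the integrated relative entropy of the two competitors.  A solution
  is found by shooting from the left end point, where \<open>F\<close> ranges over \<open>(\<alpha>, \<beta>]\<close>, and the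
  intermediate value theorem for the right boundary condition.  For fixed \<open>F\<close>,
  \<open>G(\<gamma>, F)\<close> is convex in \<open>\<gamma>\<close> and a supremum of weakly continuous affine functionals, and
  both properties pass to the supremum over \<open>F\<close>.\<close>

section \<open>Primitives of bounded measurable functions\<close>

text \<open>With \<open>F = exp \<phi> / (1 + exp \<phi>)\<close> the integrand is, apart from terms
  free of \<open>F\<close>, equal to
  \<open>ln \<phi>' + (1 - \<gamma>) * \<phi> - ln (1 + exp \<phi>)\<close>. The concavity and the
  equation for \<open>1 / \<phi>'\<close> can be read off from this formula; the relative entropy is
  the defect in the tangent inequality for \<open>ln (1 + exp \<phi>)\<close>. The obstacle is that
  \<gamma> is merely measurable: the equation for \<open>F''\<close> holds only almost everywhere,
  and the vector field of the shooting problem may be discontinuous in \<open>x\<close>.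
  Differential equations are therefore used in integrated form, with a product rule and an
  exponential rule for primitives of bounded measurable functions. Shooting could also fail by
  blow-up of \<open>F'\<close>. The variable \<open>F^2 / F'\<close> excludes this: it is
  nondecreasing along solutions, whatever \<gamma> is, so \<open>F'\<close> stays bounded while
  \<open>F\<close> is below \<beta>. Finally, the weak topology tests only with continuous
  functions, and oscillating densities lose entropy in the limit. Hence the entropy is only lower
  semicontinuous, and \<gamma> has to be approximated by continuous densities.\<close>

definition bdd_measurable :: "(real \<Rightarrow> 'a::euclidean_space) \<Rightarrow> bool" where
  "bdd_measurable g \<longleftrightarrow> g \<in> borel_measurable (restrict_space borel {0..1}) \<and> bounded (g ` {0..1})"

text \<open>Here \<open>f\<close> is Lipschitz on the unit interval and \<open>g\<close> is a
  bounded version of its almost everywhere derivative. The integral form admits discontinuous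
  \<open>g\<close>, as occurs when \<open>g\<close> contains \<gamma>.\<close>

definition primitive :: "(real \<Rightarrow> real) \<Rightarrow> (real \<Rightarrow> real) \<Rightarrow> bool" where
  "primitive f g \<longleftrightarrow> bdd_measurable g \<and> (\<forall>x\<in>{0..1}. (g has_integral (f x - f 0)) {0..x})"

lemma bdd_measurable_measurable: "bdd_measurable g \<Longrightarrow> g \<in> borel_measurable (restrict_space borel {0..1})"
  by (simp add: bdd_measurable_def)

lemma bdd_measurable_bound:
  assumes "bdd_measurable g"
  obtains M where "M > 0" "\<And>x. x \<in> {0..1} \<Longrightarrow> norm (g x) \<le> M"
  using assms unfolding bdd_measurable_def bounded_pos by blast

lemma bdd_measurableI:
  assumes "g \<in> borel_measurable (restrict_space borel {0..1})"
    and "\<And>x. x \<in> {0..1} \<Longrightarrow> norm (g x) \<le> M"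
  shows "bdd_measurable g"
  using assms unfolding bdd_measurable_def bounded_iff by blast

lemma bdd_measurable_continuous:
  assumes "continuous_on {0..1} g"
  shows "bdd_measurable g"
  unfolding bdd_measurable_def
proof
  show "g \<in> borel_measurable (restrict_space borel {0..1})"
    by (rule borel_measurable_continuous_on_restrict[OF assms])
  show "bounded (g ` {0..1})"
    by (intro compact_imp_bounded compact_continuous_image assms compact_Icc)
qed

lemma bdd_measurable_cong:
  assumes "bdd_measurable f" and "\<And>x. x \<in> {0..1} \<Longrightarrow> f x = g x"
  shows "bdd_measurable g"
proof -
  have "g \<in> borel_measurable (restrict_space borel {0..1}) \<longleftrightarrow>
        f \<in> borel_measurable (restrict_space borel {0..1})"
    by (rule measurable_cong) (use assms in \<open>auto simp: space_restrict_space\<close>)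
  moreover have "g ` {0..1} = f ` {0..1}" using assms(2) by (auto simp: image_def)
  ultimately show ?thesis using assms(1) by (simp add: bdd_measurable_def)
qed

lemma bdd_measurable_add: "bdd_measurable f \<Longrightarrow> bdd_measurable g \<Longrightarrow> bdd_measurable (\<lambda>x. f x + g x)"
  unfolding bdd_measurable_def by (intro conjI borel_measurable_add bounded_plus_comp) auto

lemma bdd_measurable_minus: "bdd_measurable f \<Longrightarrow> bdd_measurable (\<lambda>x. - f x)"
  unfolding bdd_measurable_def by (auto simp: image_comp[symmetric, of uminus f, unfolded comp_def]
      intro: borel_measurable_uminus)

lemma bdd_measurable_diff: "bdd_measurable f \<Longrightarrow> bdd_measurable g \<Longrightarrow> bdd_measurable (\<lambda>x. f x - g x)"
  using bdd_measurable_add[of f "\<lambda>x. - g x"] bdd_measurable_minus[of g] by simp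

lemma bdd_measurable_const: "bdd_measurable (\<lambda>x. c)"
  by (rule bdd_measurable_continuous) auto

lemma bdd_measurable_mult:
  fixes f g :: "real \<Rightarrow> real"
  assumes "bdd_measurable f" "bdd_measurable g"
  shows "bdd_measurable (\<lambda>x. f x * g x)"
proof -
  obtain M where M: "M > 0" "\<And>x. x \<in> {0..1} \<Longrightarrow> norm (f x) \<le> M" using bdd_measurable_bound[OF assms(1)] by blast
  obtain N where N: "N > 0" "\<And>x. x \<in> {0..1} \<Longrightarrow> norm (g x) \<le> N" using bdd_measurable_bound[OF assms(2)] by blast
  show ?thesis
    by (rule bdd_measurableI[of _ "M * N"])
      (use assms M N in \<open>auto simp: bdd_measurable_def abs_mult intro!: mult_mono\<close>)
qed

lemmas bdd_measurable_intros = bdd_measurable_add bdd_measurable_minus bdd_measurable_diff bdd_measurable_const bdd_measurable_mult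

lemma bdd_measurable_set_integrable:
  fixes g :: "real \<Rightarrow> 'a::euclidean_space"
  assumes "bdd_measurable g" "0 \<le> a" "b \<le> 1"
  shows "set_integrable lborel {a..b} g"
proof -
  obtain M where M: "M > 0" "\<And>x. x \<in> {0..1} \<Longrightarrow> norm (g x) \<le> M" using bdd_measurable_bound[OF assms(1)] by blast
  have "set_borel_measurable borel {0..1} g"
    using assms(1) by (simp add: bdd_measurable_def borel_measurable_restrict_space_iff set_borel_measurable_def)
  then have "set_integrable lborel {0..1} g"
    unfolding set_integrable_def set_borel_measurable_def
    by (intro integrableI_bounded_set[where A = "{0..1}" and B = M])
      (use M in \<open>auto split: split_indicator simp: indicator_def\<close>)
  then show ?thesis
    by (rule set_integrable_subset) (use assms in auto)
qed

lemma bdd_measurable_integrable_on: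
  fixes g :: "real \<Rightarrow> 'a::euclidean_space"
  assumes "bdd_measurable g" "0 \<le> a" "b \<le> 1"
  shows "g integrable_on {a..b}"
  using set_borel_integral_eq_integral(1)[OF bdd_measurable_set_integrable[OF assms]] .

lemma bdd_measurable_LINT:
  fixes g :: "real \<Rightarrow> 'a::euclidean_space"
  assumes "bdd_measurable g" "0 \<le> a" "b \<le> 1"
  shows "(LINT x:{a..b}|lborel. g x) = integral {a..b} g"
  using set_borel_integral_eq_integral(2)[OF bdd_measurable_set_integrable[OF assms]] .

lemma primitiveI:
  assumes "bdd_measurable g" "\<And>x. x \<in> {0..1} \<Longrightarrow> f x = c + integral {0..x} g"
  shows "primitive f g"
  unfolding primitive_def
proof (intro conjI ballI assms(1))
  fix x :: real assume x: "x \<in> {0..1}"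
  have "f 0 = c" using assms(2)[of 0] by simp
  then have "f x - f 0 = integral {0..x} g" using assms(2)[OF x] by simp
  then show "(g has_integral (f x - f 0)) {0..x}"
    using integrable_integral[OF bdd_measurable_integrable_on[OF assms(1), of 0 x]] x by simp
qed

lemma primitive_bdd_measurable: "primitive f g \<Longrightarrow> bdd_measurable g"
  by (simp add: primitive_def)

lemma primitive_eq: "primitive f g \<Longrightarrow> x \<in> {0..1} \<Longrightarrow> f x = f 0 + integral {0..x} g"
  using integral_unique[of g "f x - f 0" "{0..x}"] by (simp add: primitive_def)

lemma primitive_integral: "bdd_measurable g \<Longrightarrow> primitive (\<lambda>x. c + integral {0..x} g) g"
  by (rule primitiveI) auto

lemma primitive_diff:
  assumes "primitive f g" "0 \<le> x" "x \<le> y" "y \<le> 1"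
  shows "(g has_integral (f y - f x)) {x..y}"
proof -
  have i: "g integrable_on {a..b}" if "0 \<le> a" "b \<le> 1" for a b
    using bdd_measurable_integrable_on[OF primitive_bdd_measurable[OF assms(1)] that] .
  have "integral {0..x} g + integral {x..y} g = integral {0..y} g"
    by (rule Henstock_Kurzweil_Integration.integral_combine) (use assms i in auto)
  then have "integral {x..y} g = f y - f x"
    using primitive_eq[OF assms(1), of x] primitive_eq[OF assms(1), of y] assms by auto
  then show ?thesis using integrable_integral[OF i[of x y]] assms by auto
qed

lemma primitive_lipschitz:
  assumes "primitive f g" "\<And>x. x \<in> {0..1} \<Longrightarrow> \<bar>g x\<bar> \<le> M" "M \<ge> 0" "x \<in> {0..1}" "y \<in> {0..1}"
  shows "\<bar>f y - f x\<bar> \<le> M * \<bar>y - x\<bar>"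
proof -
  have *: "\<bar>f y - f x\<bar> \<le> M * (y - x)" if "0 \<le> x" "x \<le> y" "y \<le> 1" for x y
    using has_integral_bound[of M g "f y - f x" x y] primitive_diff[OF assms(1) that] assms that by auto
  show ?thesis
    using *[of x y] *[of y x] assms by (cases "x \<le> y") (auto simp: abs_minus_commute)
qed

lemma primitive_continuous_on:
  assumes "primitive f g"
  shows "continuous_on {0..1} f"
proof -
  have "continuous_on {0..1} (\<lambda>x. f 0 + integral {0..x} g)"
    using bdd_measurable_integrable_on[OF primitive_bdd_measurable[OF assms], of 0 1]
    by (intro continuous_on_add continuous_on_const indefinite_integral_continuous_1) simp
  then show ?thesis
    by (rule continuous_on_eq) (rule primitive_eq[OF assms, symmetric])
qed

lemma primitive_bdd_measurable_fun: "primitive f g \<Longrightarrow> bdd_measurable f"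
  by (intro bdd_measurable_continuous primitive_continuous_on)

lemma primitive_cong:
  assumes "primitive f g" "\<And>x. x \<in> {0..1} \<Longrightarrow> f x = f' x" "\<And>x. x \<in> {0..1} \<Longrightarrow> g x = g' x"
  shows "primitive f' g'"
proof (rule primitiveI[of _ _ "f 0"])
  show "bdd_measurable g'" by (rule bdd_measurable_cong[OF primitive_bdd_measurable[OF assms(1)] assms(3)])
  fix x :: real assume x: "x \<in> {0..1}"
  have "integral {0..x} g = integral {0..x} g'"
    by (rule integral_cong) (use assms(3) x in auto)
  then show "f' x = f 0 + integral {0..x} g'" using primitive_eq[OF assms(1) x] assms(2)[OF x] by simp
qed

lemma primitive_zero_const:
  assumes "primitive f g" "\<And>x. x \<in> {0..1} \<Longrightarrow> g x = 0" "x \<in> {0..1}"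
  shows "f x = f 0"
proof -
  have "integral {0..x} g = integral {0..x} (\<lambda>_. 0)"
    by (rule integral_cong) (use assms in auto)
  then show ?thesis using primitive_eq[OF assms(1,3)] by simp
qed

lemma primitive_C1:
  assumes "\<And>x. x \<in> {0..1} \<Longrightarrow> (f has_real_derivative f' x) (at x within {0..1})"
    and "continuous_on {0..1} f'"
  shows "primitive f f'"
  unfolding primitive_def
proof (intro conjI ballI bdd_measurable_continuous assms(2))
  fix x :: real assume x: "x \<in> {0..1}"
  show "(f' has_integral f x - f 0) {0..x}"
  proof (rule fundamental_theorem_of_calculus)
    fix y assume y: "y \<in> {0..x}"
    have "(f has_real_derivative f' y) (at y within {0..x})"
      by (rule DERIV_subset[OF assms(1)]) (use x y in auto)
    then show "(f has_vector_derivative f' y) (at y within {0..x})"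
      by (simp add: has_real_derivative_iff_has_vector_derivative)
  qed (use x in auto)
qed

lemma primitive_deriv:
  assumes "primitive f g" "continuous_on {0..1} g" "x \<in> {0..1}"
  shows "(f has_real_derivative g x) (at x within {0..1})"
proof -
  have "((\<lambda>x. integral {0..x} g) has_real_derivative g x) (at x within {0..1})"
    using integral_has_real_derivative[OF assms(2,3)] .
  then have "((\<lambda>x. f 0 + integral {0..x} g) has_real_derivative g x) (at x within {0..1})"
    by (auto intro!: derivative_eq_intros)
  then show ?thesis
    by (rule has_field_derivative_transform_within[where d = 1])
      (use assms(3) primitive_eq[OF assms(1), symmetric] in auto)
qed

text \<open>A function whose increments are of second order has zero derivative; this replaces
  the theory of absolutely continuous functions.\<close>

lemma primitiveI_quadratic:
  assumes g: "bdd_measurable g"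
    and quad: "\<And>x y. 0 \<le> x \<Longrightarrow> x \<le> y \<Longrightarrow> y \<le> 1 \<Longrightarrow>
      \<bar>f y - f x - integral {x..y} g\<bar> \<le> C * (y - x)\<^sup>2"
  shows "primitive f g"
proof (rule primitiveI[OF g])
  define u where "u x = f x - integral {0..x} g" for x
  have inc: "u y - u x = f y - f x - integral {x..y} g" if "0 \<le> x" "x \<le> y" "y \<le> 1" for x y
  proof -
    have "integral {0..x} g + integral {x..y} g = integral {0..y} g"
      by (rule Henstock_Kurzweil_Integration.integral_combine)
        (use that bdd_measurable_integrable_on[OF g] in auto)
    then show ?thesis by (simp add: u_def)
  qed
  have q: "\<bar>u y - u x\<bar> \<le> C * (y - x)\<^sup>2" if "x \<in> {0..1}" "y \<in> {0..1}" for x y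
    using inc[of x y] inc[of y x] quad[of x y] quad[of y x] that
    by (cases "x \<le> y") (auto simp: abs_minus_commute power2_commute)
  have d: "(u has_real_derivative 0) (at x within {0..1})" if x: "x \<in> {0..1}" for x
    unfolding has_field_derivative_iff
  proof (rule Lim_null_comparison[where g = "\<lambda>y. C * \<bar>y - x\<bar>"])
    show "\<forall>\<^sub>F y in at x within {0..1}. norm ((u y - u x) / (y - x)) \<le> C * \<bar>y - x\<bar>"
      unfolding eventually_at_filter
    proof (intro always_eventually allI impI)
      fix y assume y: "y \<noteq> x" "y \<in> {0..1}"
      have "\<bar>u y - u x\<bar> \<le> C * \<bar>y - x\<bar> * \<bar>y - x\<bar>"
        using q[OF x y(2)] by (simp add: power2_eq_square)
      then show "norm ((u y - u x) / (y - x)) \<le> C * \<bar>y - x\<bar>"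
        using y by (simp add: abs_divide pos_divide_le_eq)
    qed
    have "((\<lambda>y. C * \<bar>y - x\<bar>) \<longlongrightarrow> C * \<bar>x - x\<bar>) (at x within {0..1})"
      by (intro tendsto_intros)
    then show "((\<lambda>y. C * \<bar>y - x\<bar>) \<longlongrightarrow> 0) (at x within {0..1})" by simp
  qed
  fix x :: real assume x: "x \<in> {0..1}"
  have "\<exists>c. \<forall>x\<in>{0..1}. u x = c"
    using d by (intro has_field_derivative_zero_constant) auto
  then have "u x = u 0" using x by auto
  then show "f x = f 0 + integral {0..x} g" by (simp add: u_def)
qed

section \<open>Sum, product and exponential rules for primitives\<close>

lemma primitive_add:
  assumes "primitive f f'" "primitive g g'"
  shows "primitive (\<lambda>x. f x + g x) (\<lambda>x. f' x + g' x)"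
  unfolding primitive_def
proof (intro conjI ballI bdd_measurable_add primitive_bdd_measurable[OF assms(1)] primitive_bdd_measurable[OF assms(2)])
  fix x :: real assume x: "x \<in> {0..1}"
  have "((\<lambda>x. f' x + g' x) has_integral (f x - f 0) + (g x - g 0)) {0..x}"
    by (rule has_integral_add) (use assms x in \<open>auto simp: primitive_def\<close>)
  then show "((\<lambda>x. f' x + g' x) has_integral f x + g x - (f 0 + g 0)) {0..x}"
    by (simp add: algebra_simps)
qed

lemma primitive_minus:
  assumes "primitive f f'"
  shows "primitive (\<lambda>x. - f x) (\<lambda>x. - f' x)"
  unfolding primitive_def
proof (intro conjI ballI bdd_measurable_minus primitive_bdd_measurable[OF assms(1)])
  fix x :: real assume x: "x \<in> {0..1}"
  have "((\<lambda>x. - f' x) has_integral - (f x - f 0)) {0..x}"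
    by (rule has_integral_neg) (use assms x in \<open>auto simp: primitive_def\<close>)
  then show "((\<lambda>x. - f' x) has_integral - f x - - f 0) {0..x}"
    by simp
qed

lemma primitive_const: "primitive (\<lambda>x. c) (\<lambda>x. 0)"
  by (rule primitiveI[of _ _ c]) (auto intro: bdd_measurable_const)

text \<open>Write the increment of the product as
  \<open>(f y - f x) * g y + f x * (g y - g x)\<close> and both increments as integrals. Subtracting
  the integral of the claimed derivative leaves the integral of \<open>?k\<close>, and
  \<open>?k\<close> is of order \<open>y - x\<close> because \<open>f\<close> and \<open>g\<close>
  are Lipschitz.\<close>

lemma primitive_mult:
  assumes f: "primitive f f'" and g: "primitive g g'"
  shows "primitive (\<lambda>x. f x * g x) (\<lambda>x. f' x * g x + f x * g' x)"
proof -
  obtain M where M: "M > 0" "\<And>x. x \<in> {0..1} \<Longrightarrow> norm (f' x) \<le> M" using bdd_measurable_bound[OF primitive_bdd_measurable[OF f]] by blast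
  obtain N where N: "N > 0" "\<And>x. x \<in> {0..1} \<Longrightarrow> norm (g' x) \<le> N" using bdd_measurable_bound[OF primitive_bdd_measurable[OF g]] by blast
  have bdd_measurable: "bdd_measurable (\<lambda>x. f' x * g x + f x * g' x)"
    by (intro bdd_measurable_intros primitive_bdd_measurable[OF f] primitive_bdd_measurable[OF g] primitive_bdd_measurable_fun[OF f] primitive_bdd_measurable_fun[OF g])
  show ?thesis
  proof (rule primitiveI_quadratic[OF bdd_measurable, of _ "2 * M * N"])
    fix x y :: real assume xy: "0 \<le> x" "x \<le> y" "y \<le> 1"
    let ?k = "\<lambda>t. f' t * (g y - g t) + (f x - f t) * g' t"
    have "((\<lambda>t. f' t * g y + f x * g' t - (f' t * g t + f t * g' t))
        has_integral (f y - f x) * g y + f x * (g y - g x) - integral {x..y} (\<lambda>x. f' x * g x + f x * g' x)) {x..y}"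
      using xy
      by (intro has_integral_diff has_integral_add has_integral_mult_left has_integral_mult_right
          primitive_diff[OF f] primitive_diff[OF g] integrable_integral bdd_measurable_integrable_on[OF bdd_measurable]) auto
    moreover have "f' t * g y + f x * g' t - (f' t * g t + f t * g' t) = ?k t" for t
      by (simp add: left_diff_distrib right_diff_distrib)
    moreover have "(f y - f x) * g y + f x * (g y - g x) = f y * g y - f x * g x"
      by (simp add: left_diff_distrib right_diff_distrib)
    ultimately have k: "(?k has_integral f y * g y - f x * g x - integral {x..y} (\<lambda>x. f' x * g x + f x * g' x)) {x..y}"
      by simp
    have b: "norm (?k t) \<le> 2 * M * N * (y - x)" if t: "t \<in> {x..y}" for t
    proof -
      have 1: "\<bar>g y - g t\<bar> \<le> N * (y - x)"
        using primitive_lipschitz[OF g, of N t y] N t xy mult_left_mono[of "y - t" "y - x" N]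
        by (auto intro: order_trans)
      have 2: "\<bar>f x - f t\<bar> \<le> M * (y - x)"
        using primitive_lipschitz[OF f, of M t x] M t xy mult_left_mono[of "t - x" "y - x" M]
        by (auto intro: order_trans)
      have "\<bar>f' t * (g y - g t)\<bar> \<le> M * (N * (y - x))"
        unfolding abs_mult by (intro mult_mono 1) (use M t xy in auto)
      moreover have "\<bar>(f x - f t) * g' t\<bar> \<le> (M * (y - x)) * N"
        unfolding abs_mult by (intro mult_mono 2) (use M N t xy in auto)
      ultimately show ?thesis by (simp add: algebra_simps)
    qed
    have "norm (f y * g y - f x * g x - integral {x..y} (\<lambda>x. f' x * g x + f x * g' x))
        \<le> 2 * M * N * (y - x) * measure lborel {x..y}"
      by (rule has_integral_bound[OF _ k[unfolded box_real(2)[symmetric]], unfolded box_real(2)])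
        (use M N xy b in auto)
    then show "\<bar>f y * g y - f x * g x - integral {x..y} (\<lambda>x. f' x * g x + f x * g' x)\<bar>
        \<le> 2 * M * N * (y - x)\<^sup>2"
      using xy by (simp add: power2_eq_square)
  qed
qed

text \<open>Two errors are of second order in \<open>y - x\<close>: the Taylor remainder of
  \<open>exp\<close> between \<open>f x\<close> and \<open>f y\<close>, and the error of freezing
  \<open>exp (f t)\<close> at \<open>exp (f x)\<close> under the integral.\<close>

lemma primitive_exp:
  assumes f: "primitive f g"
  shows "primitive (\<lambda>x. exp (f x)) (\<lambda>x. exp (f x) * g x)"
proof -
  obtain M where M: "M > 0" "\<And>x. x \<in> {0..1} \<Longrightarrow> norm (g x) \<le> M" using bdd_measurable_bound[OF primitive_bdd_measurable[OF f]] by blast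
  obtain K where K: "K > 0" "\<And>x. x \<in> {0..1} \<Longrightarrow> norm (f x) \<le> K" using bdd_measurable_bound[OF primitive_bdd_measurable_fun[OF f]] by blast
  have "continuous_on {0..1} (\<lambda>x. exp (f x))"
    by (intro continuous_intros primitive_continuous_on[OF f])
  then have bdd_measurable: "bdd_measurable (\<lambda>x. exp (f x) * g x)"
    by (intro bdd_measurable_mult primitive_bdd_measurable[OF f] bdd_measurable_continuous)
  \<comment> \<open>The constant \<open>3 * K\<close> bounds \<open>b + t\<close>, since
    \<open>\<bar>b\<bar> \<le> K\<close> and the intermediate point satisfies
    \<open>\<bar>t\<bar> \<le> \<bar>a - b\<bar> \<le> 2 * K\<close>.\<close>
  have e: "\<bar>exp a - exp b - exp b * (a - b)\<bar> \<le> exp (3 * K) * (a - b)\<^sup>2"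
    if ab: "\<bar>a\<bar> \<le> K" "\<bar>b\<bar> \<le> K" for a b
  proof -
    obtain t where t: "\<bar>t\<bar> \<le> \<bar>a - b\<bar>"
      "exp (a - b) = (\<Sum>m<2. (a - b) ^ m / fact m) + exp t / fact 2 * (a - b) ^ 2"
      using Maclaurin_exp_le[of "a - b" 2] by blast
    have "exp a - exp b - exp b * (a - b) = exp b * (exp (a - b) - 1 - (a - b))"
      unfolding exp_diff by (simp add: field_simps)
    also have "\<dots> = exp (b + t) / 2 * (a - b)\<^sup>2"
      unfolding t(2) by (simp add: numeral_2_eq_2 exp_add)
    finally have "\<bar>exp a - exp b - exp b * (a - b)\<bar> = \<bar>exp (b + t) / 2 * (a - b)\<^sup>2\<bar>"
      by (rule arg_cong)
    also have "\<dots> = exp (b + t) / 2 * (a - b)\<^sup>2" by simp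
    also have "\<dots> \<le> exp (3 * K) * (a - b)\<^sup>2"
    proof (rule mult_right_mono)
      have "exp (b + t) \<le> exp (3 * K)" using t(1) ab by simp
      then show "exp (b + t) / 2 \<le> exp (3 * K)" using exp_gt_zero[of "b + t"] by linarith
    qed auto
    finally show ?thesis .
  qed
  have e1: "\<bar>exp a - exp b\<bar> \<le> exp K * \<bar>a - b\<bar>" if ab: "\<bar>a\<bar> \<le> K" "\<bar>b\<bar> \<le> K" for a b :: real
  proof -
    have *: "exp a - exp b \<le> exp K * (a - b)" if "b \<le> a" "\<bar>a\<bar> \<le> K" for a b :: real
    proof -
      have "exp a - exp b = exp a * (1 - exp (b - a))"
        unfolding exp_diff by (simp add: field_simps)
      also have "\<dots> \<le> exp a * (a - b)"
      proof (rule mult_left_mono)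
        show "1 - exp (b - a) \<le> a - b" using exp_ge_add_one_self[of "b - a"] by linarith
      qed simp
      also have "\<dots> \<le> exp K * (a - b)" using that by (intro mult_right_mono) auto
      finally show ?thesis .
    qed
    show ?thesis using *[of b a] *[of a b] ab by (cases "b \<le> a") auto
  qed
  show ?thesis
  proof (rule primitiveI_quadratic[OF bdd_measurable, of _ "exp (3 * K) * M\<^sup>2 + exp K * M * M"])
    fix x y :: real assume xy: "0 \<le> x" "x \<le> y" "y \<le> 1"
    have "((\<lambda>t. exp (f t) * g t - exp (f x) * g t)
        has_integral integral {x..y} (\<lambda>x. exp (f x) * g x) - exp (f x) * (f y - f x)) {x..y}"
      using xy
      by (intro has_integral_diff has_integral_mult_right
          primitive_diff[OF f] integrable_integral bdd_measurable_integrable_on[OF bdd_measurable]) auto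
    moreover have "norm (exp (f t) * g t - exp (f x) * g t) \<le> exp K * M * (y - x) * M"
      if t: "t \<in> {x..y}" for t
    proof -
      have "\<bar>exp (f t) - exp (f x)\<bar> \<le> exp K * \<bar>f t - f x\<bar>"
        by (rule e1) (use K t xy in auto)
      also have "\<bar>f t - f x\<bar> \<le> M * (y - x)"
        using primitive_lipschitz[OF f, of M x t] M t xy mult_left_mono[of "t - x" "y - x" M]
        by (auto intro: order_trans)
      finally have "\<bar>exp (f t) - exp (f x)\<bar> * \<bar>g t\<bar> \<le> exp K * (M * (y - x)) * M"
        by (intro mult_mono) (use M t xy in auto)
      moreover have "exp (f t) * g t - exp (f x) * g t = (exp (f t) - exp (f x)) * g t"
        by (rule left_diff_distrib[symmetric])
      ultimately show ?thesis by (simp only: real_norm_def abs_mult mult.assoc)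
    qed
    ultimately have "norm (integral {x..y} (\<lambda>x. exp (f x) * g x) - exp (f x) * (f y - f x))
        \<le> exp K * M * (y - x) * M * measure lborel {x..y}"
      using M xy
      by (intro has_integral_bound[of "exp K * M * (y - x) * M"
          "\<lambda>t. exp (f t) * g t - exp (f x) * g t" _ x y, unfolded box_real(2)]) auto
    then have 1: "\<bar>integral {x..y} (\<lambda>x. exp (f x) * g x) - exp (f x) * (f y - f x)\<bar>
        \<le> exp K * M * M * (y - x)\<^sup>2"
      using xy by (simp add: power2_eq_square mult_ac)
    have "\<bar>exp (f y) - exp (f x) - exp (f x) * (f y - f x)\<bar> \<le> exp (3 * K) * (f y - f x)\<^sup>2"
      by (rule e) (use K xy in auto)
    also have "\<dots> \<le> exp (3 * K) * (M * (y - x))\<^sup>2"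
      using primitive_lipschitz[OF f, of M x y] M xy by (intro mult_left_mono abs_le_square_iff[THEN iffD1]) auto
    finally have 2: "\<bar>exp (f y) - exp (f x) - exp (f x) * (f y - f x)\<bar> \<le> exp (3 * K) * M\<^sup>2 * (y - x)\<^sup>2"
      by (simp add: power_mult_distrib mult.assoc)
    show "\<bar>exp (f y) - exp (f x) - integral {x..y} (\<lambda>x. exp (f x) * g x)\<bar>
        \<le> (exp (3 * K) * M\<^sup>2 + exp K * M * M) * (y - x)\<^sup>2"
      unfolding distrib_right using 1 2 by linarith
  qed
qed

section \<open>Caratheodory differential equations\<close>

lemma summable_differences_convergent:
  fixes Y :: "nat \<Rightarrow> 'a::banach"
  assumes "\<And>n. norm (Y (Suc n) - Y n) \<le> c * (1/2) ^ n"
  shows "convergent Y"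
proof -
  have "summable (\<lambda>n. Y (Suc n) - Y n)"
    by (rule summable_comparison_test'[where g = "\<lambda>n. c * (1/2) ^ n" and N = 0])
      (use assms in \<open>auto intro!: summable_mult summable_geometric\<close>)
  then have "convergent (\<lambda>n. Y n - Y 0)"
    by (simp add: summable_iff_convergent sum_lessThan_telescope)
  then have "convergent (\<lambda>n. (Y n - Y 0) + Y 0)"
    by (rule convergent_add) (rule convergent_const)
  then show ?thesis by simp
qed

lemma integral_exp_weight:
  fixes L :: real
  assumes "L > 0" "0 \<le> x"
  shows "((\<lambda>t. L * (K * exp (2 * L * t))) has_integral K * (exp (2 * L * x) - 1) / 2) {0..x}"
proof -
  have "((\<lambda>t. L * (K * exp (2 * L * t))) has_integral
      K * exp (2 * L * x) / 2 - K * exp (2 * L * 0) / 2) {0..x}"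
    by (rule fundamental_theorem_of_calculus)
      (use assms in \<open>auto intro!: derivative_eq_intros
        simp flip: has_real_derivative_iff_has_vector_derivative\<close>)
  then show ?thesis by (simp add: field_simps)
qed

text \<open>Bielecki's weight: relative to \<open>exp (2 * L * t)\<close>, integrating a term with
  Lipschitz constant \<open>L\<close> contracts by one half on the whole interval, however large
  \<open>L\<close> is.\<close>

lemma integral_weighted_le:
  fixes g :: "real \<Rightarrow> 'a::euclidean_space"
  assumes "bdd_measurable g" "L > 0" "K \<ge> 0" "x \<in> {0..1}"
    and "\<And>t. t \<in> {0..x} \<Longrightarrow> norm (g t) \<le> L * (K * exp (2 * L * t))"
  shows "norm (integral {0..x} g) \<le> K / 2 * exp (2 * L * x)"
proof -
  have "norm (integral {0..x} g) \<le> integral {0..x} (\<lambda>t. L * (K * exp (2 * L * t)))"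
    by (rule integral_norm_bound_integral)
      (use assms bdd_measurable_integrable_on[OF assms(1), of 0 x] integral_exp_weight[of L x K] in auto)
  also have "\<dots> = K * (exp (2 * L * x) - 1) / 2"
    by (rule integral_unique[OF integral_exp_weight]) (use assms in auto)
  also have "\<dots> \<le> K / 2 * exp (2 * L * x)"
    using assms by (simp add: field_simps)
  finally show ?thesis .
qed

text \<open>Picard iteration. As \<open>f\<close> may be discontinuous in \<open>t\<close>,
  \<open>meas\<close> asks only that superposition preserve measurability. Pointwise convergence of
  the iterates suffices: the limit is measurable, and the bound \<open>M\<close> permits dominated
  convergence in the integral equation.\<close>

theorem caratheodory_existence:
  fixes f :: "real \<Rightarrow> 'a::euclidean_space \<Rightarrow> 'a"
  assumes meas: "\<And>y. y \<in> borel_measurable (restrict_space borel {0..1}) \<Longrightarrow>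
      (\<lambda>t. f t (y t)) \<in> borel_measurable (restrict_space borel {0..1})"
    and bound: "\<And>t y. t \<in> {0..1} \<Longrightarrow> norm (f t y) \<le> M"
    and lip: "\<And>t y z. t \<in> {0..1} \<Longrightarrow> norm (f t y - f t z) \<le> L * norm (y - z)"
    and L: "L > 0"
  shows "\<exists>y. bdd_measurable (\<lambda>t. f t (y t)) \<and> (\<forall>x\<in>{0..1}. y x = y0 + integral {0..x} (\<lambda>t. f t (y t)))"
proof -
  define Y where "Y n = ((\<lambda>y x. y0 + integral {0..x} (\<lambda>t. f t (y t))) ^^ n) (\<lambda>_. y0)" for n
  have Y0: "Y 0 = (\<lambda>_. y0)" and YS: "Y (Suc n) x = y0 + integral {0..x} (\<lambda>t. f t (Y n t))" for n x
    by (simp_all add: Y_def)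
  have bmf: "bdd_measurable (\<lambda>t. f t (y t))" if "y \<in> borel_measurable (restrict_space borel {0..1})" for y
    by (rule bdd_measurableI[OF meas[OF that] bound])
  have cont: "continuous_on {0..1} (\<lambda>x. y0 + integral {0..x} (\<lambda>t. f t (y t)))"
    if "y \<in> borel_measurable (restrict_space borel {0..1})" for y
    using bdd_measurable_integrable_on[OF bmf[OF that], of 0 1]
    by (intro continuous_on_add continuous_on_const indefinite_integral_continuous_1) simp
  have Ym: "Y n \<in> borel_measurable (restrict_space borel {0..1})" for n
  proof (induction n)
    case 0 then show ?case by (simp add: Y0)
  next
    case (Suc n)
    then show ?case
      using borel_measurable_continuous_on_restrict[OF cont[OF Suc]] YS by presburger
  qed
  have M: "M \<ge> 0" using order_trans[OF norm_ge_zero bound[of 0 0]] by simp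
  \<comment> \<open>The weight halves the distance of successive iterates; the induction starts
    because \<open>x \<le> 1 \<le> exp (2 * L * x)\<close>.\<close>
  have step: "norm (Y (Suc n) x - Y n x) \<le> M * (1/2) ^ n * exp (2 * L * x)"
    if "x \<in> {0..1}" for n x
    using that
  proof (induction n arbitrary: x)
    case 0
    have "norm (integral {0..x} (\<lambda>t. f t (Y 0 t))) \<le> M * (x - 0)"
      using 0 M bound has_integral_bound[OF M, of "\<lambda>t. f t (Y 0 t)" _ 0 x, unfolded box_real(2)]
        integrable_integral[OF bdd_measurable_integrable_on[OF bmf[OF Ym[of 0]], of 0 x]] by auto
    also have "\<dots> \<le> M * exp (2 * L * x)"
    proof (rule mult_left_mono)
      have "1 \<le> exp (2 * L * x)" using 0 L by simp
      moreover have "x \<le> 1" using 0 by simp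
      ultimately show "x - 0 \<le> exp (2 * L * x)" by linarith
    qed (rule M)
    finally show ?case using YS[of 0 x] by (simp add: Y0)
  next
    case (Suc n)
    have "Y (Suc (Suc n)) x - Y (Suc n) x
        = integral {0..x} (\<lambda>t. f t (Y (Suc n) t) - f t (Y n t))"
      unfolding YS[of "Suc n"] YS[of n x]
      using Suc bdd_measurable_integrable_on[OF bmf[OF Ym], of 0 x]
      by (subst Henstock_Kurzweil_Integration.integral_diff) auto
    also have "norm \<dots> \<le> (M * (1/2) ^ n) / 2 * exp (2 * L * x)"
    proof (rule integral_weighted_le)
      fix t assume "t \<in> {0..x}"
      then have t: "t \<in> {0..1}" using Suc by auto
      show "norm (f t (Y (Suc n) t) - f t (Y n t)) \<le> L * (M * (1 / 2) ^ n * exp (2 * L * t))"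
        using lip[OF t] mult_left_mono[OF Suc.IH[OF t], of L] L by (meson less_imp_le order_trans)
    qed (use Suc L M Ym bmf in \<open>auto intro!: bdd_measurable_diff\<close>)
    finally show ?case by simp
  qed
  have conv: "convergent (\<lambda>n. Y n x)" if x: "x \<in> {0..1}" for x
    by (rule summable_differences_convergent[where c = "M * exp (2 * L * x)"])
      (use step[OF x] in \<open>simp add: mult_ac\<close>)
  define y where "y x = lim (\<lambda>n. Y n x)" for x
  have Yy: "(\<lambda>n. Y n x) \<longlonglongrightarrow> y x" if "x \<in> {0..1}" for x
    using conv[OF that] by (simp add: y_def convergent_LIMSEQ_iff)
  have ym: "y \<in> borel_measurable (restrict_space borel {0..1})"
    by (rule borel_measurable_LIMSEQ_metric[where f = Y, OF Ym]) (use Yy in \<open>auto simp: space_restrict_space\<close>)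
  have "y x = y0 + integral {0..x} (\<lambda>t. f t (y t))" if x: "x \<in> {0..1}" for x
  proof -
    have "(\<lambda>n. integral {0..x} (\<lambda>t. f t (Y n t))) \<longlonglongrightarrow> integral {0..x} (\<lambda>t. f t (y t))"
    proof (rule dominated_convergence(2)[where h = "\<lambda>_. M"])
      fix t assume "t \<in> {0..x}"
      then have t: "t \<in> {0..1}" using x by auto
      have "(\<lambda>n. f t (Y n t) - f t (y t)) \<longlonglongrightarrow> 0"
      proof (rule Lim_null_comparison)
        show "\<forall>\<^sub>F n in sequentially. norm (f t (Y n t) - f t (y t)) \<le> L * norm (Y n t - y t)"
          using lip[OF t] by auto
        have "(\<lambda>n. L * norm (Y n t - y t)) \<longlonglongrightarrow> L * norm (y t - y t)"
          by (intro tendsto_intros Yy t)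
        then show "(\<lambda>n. L * norm (Y n t - y t)) \<longlonglongrightarrow> 0" by simp
      qed
      then show "(\<lambda>n. f t (Y n t)) \<longlonglongrightarrow> f t (y t)" by (rule LIM_zero_cancel)
      show "norm (f t (Y n t)) \<le> M" for n by (rule bound[OF t])
    qed (use x bdd_measurable_integrable_on[OF bmf[OF Ym], of 0 x] in auto)
    then have "(\<lambda>n. y0 + integral {0..x} (\<lambda>t. f t (Y n t))) \<longlonglongrightarrow> y0 + integral {0..x} (\<lambda>t. f t (y t))"
      by (intro tendsto_intros)
    then have "(\<lambda>n. Y (Suc n) x) \<longlonglongrightarrow> y0 + integral {0..x} (\<lambda>t. f t (y t))"
      by (simp add: YS)
    moreover have "(\<lambda>n. Y (Suc n) x) \<longlonglongrightarrow> y x"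
      by (rule LIMSEQ_Suc[OF Yy[OF x]])
    ultimately show ?thesis by (rule LIMSEQ_unique[symmetric])
  qed
  then show ?thesis using bmf[OF ym] by blast
qed

text \<open>Let \<open>K\<close> be the maximum of the weighted distance. At a point where it is
  attained, the weighted integral estimate gives \<open>K \<le> norm (y0 - z0) + K / 2\<close>, and
  the half is absorbed. This later yields the continuity of the shooting map.\<close>

theorem caratheodory_dependence:
  fixes f :: "real \<Rightarrow> 'a::euclidean_space \<Rightarrow> 'a"
  assumes lip: "\<And>t y z. t \<in> {0..1} \<Longrightarrow> norm (f t y - f t z) \<le> L * norm (y - z)"
    and L: "L > 0"
    and y: "bdd_measurable (\<lambda>t. f t (y t))" "\<And>x. x \<in> {0..1} \<Longrightarrow> y x = y0 + integral {0..x} (\<lambda>t. f t (y t))"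
    and z: "bdd_measurable (\<lambda>t. f t (z t))" "\<And>x. x \<in> {0..1} \<Longrightarrow> z x = z0 + integral {0..x} (\<lambda>t. f t (z t))"
    and x: "x \<in> {0..1}"
  shows "norm (y x - z x) \<le> 2 * exp (2 * L) * norm (y0 - z0)"
proof -
  have cont: "continuous_on {0..1} u"
    if "bdd_measurable (\<lambda>t. f t (u t))" "\<And>x. x \<in> {0..1} \<Longrightarrow> u x = u0 + integral {0..x} (\<lambda>t. f t (u t))" for u u0
  proof -
    have "continuous_on {0..1} (\<lambda>x. u0 + integral {0..x} (\<lambda>t. f t (u t)))"
      using bdd_measurable_integrable_on[OF that(1), of 0 1]
      by (intro continuous_on_add continuous_on_const indefinite_integral_continuous_1) simp
    then show ?thesis by (rule continuous_on_eq) (rule that(2)[symmetric])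
  qed
  have c: "continuous_on {0..1} (\<lambda>x. norm (y x - z x) * exp (- (2 * L * x)))"
    by (intro continuous_intros cont[of y, OF y] cont[of z, OF z])
  obtain s where s: "s \<in> {0..1}" and
    smax: "\<And>t. t \<in> {0..1} \<Longrightarrow> norm (y t - z t) * exp (- (2 * L * t)) \<le> norm (y s - z s) * exp (- (2 * L * s))"
    using continuous_attains_sup[OF _ _ c] by auto
  define K where "K = norm (y s - z s) * exp (- (2 * L * s))"
  have bnd: "norm (y t - z t) \<le> K * exp (2 * L * t)" if "t \<in> {0..1}" for t
  proof -
    have "norm (y t - z t) * exp (- (2 * L * t)) * exp (2 * L * t) \<le> K * exp (2 * L * t)"
      using smax[OF that] by (intro mult_right_mono) (auto simp: K_def)
    then show ?thesis by (simp add: mult.assoc flip: exp_add)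
  qed
  have K0: "K \<ge> 0" by (simp add: K_def)
  have "y s - z s = (y0 - z0) + integral {0..s} (\<lambda>t. f t (y t) - f t (z t))"
    using y(2)[OF s] z(2)[OF s] s bdd_measurable_integrable_on[OF y(1), of 0 s] bdd_measurable_integrable_on[OF z(1), of 0 s]
    by (subst Henstock_Kurzweil_Integration.integral_diff) auto
  also have "norm \<dots> \<le> norm (y0 - z0) + norm (integral {0..s} (\<lambda>t. f t (y t) - f t (z t)))"
    by (rule norm_triangle_ineq)
  also have "norm (integral {0..s} (\<lambda>t. f t (y t) - f t (z t))) \<le> K / 2 * exp (2 * L * s)"
  proof (rule integral_weighted_le[OF _ L K0 s])
    fix t assume "t \<in> {0..s}"
    then have t: "t \<in> {0..1}" using s by auto
    show "norm (f t (y t) - f t (z t)) \<le> L * (K * exp (2 * L * t))"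
      using lip[OF t] mult_left_mono[OF bnd[OF t], of L] L by (meson less_imp_le order_trans)
  qed (intro bdd_measurable_diff y z)
  finally have "norm (y s - z s) \<le> norm (y0 - z0) + K / 2 * exp (2 * L * s)" by simp
  then have "K \<le> (norm (y0 - z0) + K / 2 * exp (2 * L * s)) * exp (- (2 * L * s))"
    unfolding K_def by (rule mult_right_mono) simp
  also have "\<dots> = norm (y0 - z0) * exp (- (2 * L * s)) + K / 2"
    by (simp add: distrib_right mult.assoc flip: exp_add)
  also have "norm (y0 - z0) * exp (- (2 * L * s)) \<le> norm (y0 - z0) * 1"
    using s L by (intro mult_left_mono) auto
  finally have K: "K \<le> 2 * norm (y0 - z0)" by simp
  have "norm (y x - z x) \<le> K * exp (2 * L * x)" by (rule bnd[OF x])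
  also have "\<dots> \<le> (2 * norm (y0 - z0)) * exp (2 * L)"
    using K K0 L x by (intro mult_mono) auto
  finally show ?thesis by (simp add: mult_ac)
qed

section \<open>The integro-differential equation\<close>

lemma M_ac_bdd_measurable: "\<gamma> \<in> M_ac \<Longrightarrow> bdd_measurable \<gamma>"
  by (rule bdd_measurableI[of _ 1]) (auto simp: M_ac_def)

lemma M_ac_range: "\<gamma> \<in> M_ac \<Longrightarrow> x \<in> {0..1} \<Longrightarrow> 0 \<le> \<gamma> x \<and> \<gamma> x \<le> 1"
  by (simp add: M_ac_def)

lemma nabla_eqI:
  assumes "(F has_real_derivative d) (at x within {0..1})" "x \<in> {0..1}"
  shows "nabla F x = d"
  using vector_derivative_within_cbox[of 0 1 x F d] assms
  by (simp add: nabla_def has_real_derivative_iff_has_vector_derivative)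

lemma F_set_range: "F \<in> F_set \<alpha> \<beta> \<Longrightarrow> x \<in> {0..1} \<Longrightarrow> \<alpha> < F x \<and> F x < \<beta> \<and> nabla F x > 0"
  by (simp add: F_set_def)

lemma F_set_deriv:
  assumes "F \<in> F_set \<alpha> \<beta>" "x \<in> {0..1}"
  shows "(F has_real_derivative nabla F x) (at x within {0..1})"
  using assms vector_derivative_works[of F "at x within {0..1}"]
  by (auto simp: F_set_def differentiable_on_def nabla_def has_real_derivative_iff_has_vector_derivative)

lemma F_set_nabla_continuous: "F \<in> F_set \<alpha> \<beta> \<Longrightarrow> continuous_on {0..1} (nabla F)"
  by (simp add: F_set_def)

lemma F_set_continuous: "F \<in> F_set \<alpha> \<beta> \<Longrightarrow> continuous_on {0..1} F"
  by (simp add: F_set_def differentiable_imp_continuous_on)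

lemma F_set_primitive: "F \<in> F_set \<alpha> \<beta> \<Longrightarrow> primitive F (nabla F)"
  by (rule primitive_C1) (auto intro: F_set_deriv F_set_nabla_continuous)

lemma R_fun_bdd_measurable:
  assumes "\<gamma> \<in> M_ac" "F \<in> F_set \<alpha> \<beta>" "0 < \<alpha>" "\<beta> < 1"
  shows "bdd_measurable (R_fun \<gamma> F)"
proof -
  have "F x \<noteq> 0 \<and> F x \<noteq> 1" if "x \<in> {0..1}" for x
    using F_set_range[OF assms(2) that] assms by auto
  then have "continuous_on {0..1} (\<lambda>x. nabla F x / (F x * (1 - F x)))"
    by (intro continuous_intros F_set_nabla_continuous[OF assms(2)] F_set_continuous[OF assms(2)]) auto
  then show ?thesis
    unfolding R_fun_def
    by (intro bdd_measurable_mult bdd_measurable_diff M_ac_bdd_measurable assms(1) bdd_measurable_continuous F_set_continuous[OF assms(2)])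
qed

lemma LINT_exp_R:
  fixes r :: "real \<Rightarrow> real"
  assumes "bdd_measurable r" "x \<in> {0..1}"
  shows "(LINT y:{0..x}|lborel. exp (LINT z:{0..y}|lborel. r z))
    = integral {0..x} (\<lambda>y. exp (integral {0..y} r))"
proof -
  have "(LINT y:{0..x}|lborel. exp (LINT z:{0..y}|lborel. r z))
      = (LINT y:{0..x}|lborel. exp (integral {0..y} r))"
    by (rule set_lebesgue_integral_cong) (use assms bdd_measurable_LINT[OF assms(1), of 0] in auto)
  also have "\<dots> = integral {0..x} (\<lambda>y. exp (integral {0..y} r))"
    using primitive_bdd_measurable_fun[OF primitive_exp[OF primitive_integral[OF assms(1), where c = 0]]] assms
    by (intro bdd_measurable_LINT) auto
  finally show ?thesis .
qed

text \<open>The denominator of the integro-differential equation normalises the total rise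
  \<open>\<beta> - \<alpha>\<close>. Differentiation removes it and leaves the exponential formula
  for \<open>nabla F\<close>; conversely, that formula and the two boundary conditions determine its
  value.\<close>

lemma solves_bvp_iff:
  assumes c: "0 < \<alpha>" "\<alpha> < \<beta>" "\<beta> < 1" "A > 0" "B > 0" and \<gamma>: "\<gamma> \<in> M_ac"
  shows "solves_bvp \<alpha> \<beta> A B \<gamma> F \<longleftrightarrow> F \<in> F_set \<alpha> \<beta>
    \<and> (\<forall>x\<in>{0..1}. nabla F x = nabla F 0 * exp (integral {0..x} (R_fun \<gamma> F)))
    \<and> F 0 - \<alpha> = A * nabla F 0 \<and> \<beta> - F 1 = B * nabla F 1"
proof (cases "F \<in> F_set \<alpha> \<beta>")
  case F: True
  define E where "E x = exp (integral {0..x} (R_fun \<gamma> F))" for x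
  define D where "D = A + integral {0..1} E + B * E 1"
  have bmR: "bdd_measurable (R_fun \<gamma> F)" by (rule R_fun_bdd_measurable[OF \<gamma> F]) (use c in auto)
  have Ec: "continuous_on {0..1} E"
    unfolding E_def using primitive_continuous_on[OF primitive_exp[OF primitive_integral[OF bmR, where c = 0]]] by simp
  have E0: "E 0 = 1" by (simp add: E_def)
  have Epos: "E x > 0" for x by (simp add: E_def)
  have iE: "integral {0..1} E \<ge> 0"
    by (rule integral_nonneg) (use Ec Epos less_imp_le in \<open>auto intro: integrable_continuous_real\<close>)
  have D: "D > 0" unfolding D_def using c Epos[of 1] iE by (simp add: add_pos_nonneg)
  have iff: "solves_bvp \<alpha> \<beta> A B \<gamma> F \<longleftrightarrow>
      (\<forall>x\<in>{0..1}. F x = \<alpha> + (\<beta> - \<alpha>) * ((A + integral {0..x} E) / D))"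
    using F LINT_exp_R[OF bmR] bdd_measurable_LINT[OF bmR, of 0 1]
    by (simp add: solves_bvp_def D_def E_def[abs_def])
  show ?thesis
  proof
    assume "solves_bvp \<alpha> \<beta> A B \<gamma> F"
    then have eq: "F x = \<alpha> + (\<beta> - \<alpha>) * ((A + integral {0..x} E) / D)" if "x \<in> {0..1}" for x
      using iff that by blast
    have n: "nabla F x = (\<beta> - \<alpha>) / D * E x" if x: "x \<in> {0..1}" for x
    proof (rule nabla_eqI[OF _ x])
      have "((\<lambda>x. \<alpha> + (\<beta> - \<alpha>) * ((A + integral {0..x} E) / D)) has_real_derivative
          (\<beta> - \<alpha>) / D * E x) (at x within {0..1})"
        using D by (auto intro!: derivative_eq_intros integral_has_real_derivative[OF Ec x])
      then show "(F has_real_derivative (\<beta> - \<alpha>) / D * E x) (at x within {0..1})"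
        by (rule has_field_derivative_transform_within[where d = 1]) (use eq x in auto)
    qed
    have "B * E 1 = D - (A + integral {0..1} E)" by (simp add: D_def)
    then have "B * E 1 / D = 1 - (A + integral {0..1} E) / D"
      using D by (simp add: diff_divide_distrib)
    then have "(\<beta> - \<alpha>) * (B * E 1 / D) = (\<beta> - \<alpha>) * (1 - (A + integral {0..1} E) / D)"
      by simp
    then have "\<beta> - F 1 = B * nabla F 1"
      using eq[of 1] n[of 1] by (simp add: algebra_simps)
    then show "F \<in> F_set \<alpha> \<beta>
      \<and> (\<forall>x\<in>{0..1}. nabla F x = nabla F 0 * exp (integral {0..x} (R_fun \<gamma> F)))
      \<and> F 0 - \<alpha> = A * nabla F 0 \<and> \<beta> - F 1 = B * nabla F 1"
      using F n eq[of 0] n[of 0] by (simp add: E0 flip: E_def)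
  next
    assume r: "F \<in> F_set \<alpha> \<beta>
      \<and> (\<forall>x\<in>{0..1}. nabla F x = nabla F 0 * exp (integral {0..x} (R_fun \<gamma> F)))
      \<and> F 0 - \<alpha> = A * nabla F 0 \<and> \<beta> - F 1 = B * nabla F 1"
    have nE: "nabla F x = nabla F 0 * E x" if "x \<in> {0..1}" for x
      unfolding E_def by (rule r[THEN conjunct2, THEN conjunct1, THEN bspec, OF that])
    have Fx: "F x = F 0 + nabla F 0 * integral {0..x} E" if x: "x \<in> {0..1}" for x
    proof -
      have "integral {0..x} (nabla F) = integral {0..x} (\<lambda>x. nabla F 0 * E x)"
        by (rule integral_cong, rule nE) (use x in auto)
      then show ?thesis using primitive_eq[OF F_set_primitive[OF F] x] by simp
    qed
    have bc: "F 0 - \<alpha> = A * nabla F 0" "\<beta> - F 1 = B * nabla F 1"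
      using r[THEN conjunct2, THEN conjunct2] by (rule conjunct1, rule conjunct2)
    have n1: "nabla F 1 = nabla F 0 * E 1" by (rule nE) simp
    \<comment> \<open>The total rise consists of the two jumps at the boundary and the rise on the
      interval. These are the three summands of \<open>D\<close>, each multiplied by
      \<open>nabla F 0\<close>.\<close>
    have "\<beta> - \<alpha> = (\<beta> - F 1) + (F 1 - F 0) + (F 0 - \<alpha>)" by simp
    also have "\<dots> = nabla F 0 * D"
      using bc Fx[of 1] n1 by (simp add: D_def algebra_simps)
    finally have "\<beta> - \<alpha> = nabla F 0 * D" .
    then have key: "(\<beta> - \<alpha>) * ((A + integral {0..x} E) / D) = nabla F 0 * (A + integral {0..x} E)" for x
      using D by simp
    have "F x = \<alpha> + (\<beta> - \<alpha>) * ((A + integral {0..x} E) / D)" if x: "x \<in> {0..1}" for x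
      unfolding key using Fx[OF x] bc(1) by (simp add: algebra_simps)
    then show "solves_bvp \<alpha> \<beta> A B \<gamma> F" using iff by blast
  qed
qed (simp add: solves_bvp_def)

section \<open>Solving the boundary value problem by shooting\<close>

lemma inverse_max_lipschitz:
  fixes a b m :: real
  assumes "m > 0"
  shows "\<bar>1 / max a m - 1 / max b m\<bar> \<le> 1 / m\<^sup>2 * \<bar>a - b\<bar>"
proof -
  have p: "max a m > 0" "max b m > 0" using assms by (auto simp: less_max_iff_disj)
  have "1 / max a m - 1 / max b m = (max b m - max a m) * (1 / (max a m * max b m))"
    using p by (simp add: field_simps)
  then have "\<bar>1 / max a m - 1 / max b m\<bar> = \<bar>max b m - max a m\<bar> * (1 / (max a m * max b m))"
    using p by (simp add: abs_mult)
  also have "\<dots> \<le> \<bar>a - b\<bar> * (1 / m\<^sup>2)"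
  proof (rule mult_mono)
    have "m * m \<le> max a m * max b m" by (intro mult_mono) (use assms in auto)
    then show "1 / (max a m * max b m) \<le> 1 / m\<^sup>2"
      using assms by (intro divide_left_mono) (auto simp: power2_eq_square intro!: mult_pos_pos p)
  qed (use p in \<open>auto simp: max_def\<close>)
  finally show ?thesis by (simp add: mult.commute)
qed

text \<open>For \<open>v = (1 - F) / F\<close> and \<open>\<theta> = F\<^sup>2 / F'\<close> the equation becomes the system
  \<open>v' = - 1 / \<theta>\<close>, \<open>\<theta>' = (1 - \<gamma>) / v + 1 / (1 + v)\<close>.  Since \<open>\<theta>\<close> increases, it suffices to cut off
  the singularities at \<open>v = b\<close>, corresponding to \<open>F = \<beta>\<close>, and at a lower bound \<open>m\<close> of \<open>\<theta> 0\<close>.\<close>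

definition shoot_rhs :: "(real \<Rightarrow> real) \<Rightarrow> real \<Rightarrow> real \<Rightarrow> real \<Rightarrow> real \<times> real \<Rightarrow> real \<times> real" where
  "shoot_rhs \<gamma> m b t y = (- (1 / max (snd y) m), (1 - \<gamma> t) / max (fst y) b + 1 / max (1 + fst y) (1 + b))"

lemma norm_fst_snd_le:
  fixes p :: "'a::real_normed_vector \<times> 'b::real_normed_vector"
  shows "norm (fst p) \<le> norm p" "norm (snd p) \<le> norm p"
  using norm_fst_le[of "fst p" "snd p"] norm_snd_le[of "snd p" "fst p"] by simp_all

lemma shoot_rhs_lipschitz:
  assumes "\<gamma> \<in> M_ac" "m > 0" "b > 0" "t \<in> {0..1}"
  shows "norm (shoot_rhs \<gamma> m b t y - shoot_rhs \<gamma> m b t z)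
    \<le> (1 / m\<^sup>2 + 1 / b\<^sup>2 + 1 / (1 + b)\<^sup>2) * norm (y - z)"
proof -
  have f: "\<bar>fst y - fst z\<bar> \<le> norm (y - z)" and s: "\<bar>snd y - snd z\<bar> \<le> norm (y - z)"
    using norm_fst_snd_le[of "y - z"] by simp_all
  let ?p = "1 / max (snd z) m - 1 / max (snd y) m"
  let ?q = "1 / max (fst y) b - 1 / max (fst z) b"
  let ?r = "1 / max (1 + fst y) (1 + b) - 1 / max (1 + fst z) (1 + b)"
  have "shoot_rhs \<gamma> m b t y - shoot_rhs \<gamma> m b t z = (?p, (1 - \<gamma> t) * ?q + ?r)"
    by (simp add: shoot_rhs_def right_diff_distrib)
  then have "norm (shoot_rhs \<gamma> m b t y - shoot_rhs \<gamma> m b t z) \<le> \<bar>?p\<bar> + \<bar>(1 - \<gamma> t) * ?q + ?r\<bar>"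
    using norm_Pair_le[of ?p "(1 - \<gamma> t) * ?q + ?r"] by simp
  also have "\<dots> \<le> \<bar>?p\<bar> + (\<bar>1 - \<gamma> t\<bar> * \<bar>?q\<bar> + \<bar>?r\<bar>)"
    using abs_triangle_ineq[of "(1 - \<gamma> t) * ?q" ?r] by (simp only: abs_mult add_left_mono)
  also have "\<dots> \<le> \<bar>?p\<bar> + (1 * \<bar>?q\<bar> + \<bar>?r\<bar>)"
    using M_ac_range[OF assms(1,4)] by (intro add_mono mult_mono) auto
  also have "\<dots> \<le> 1 / m\<^sup>2 * norm (y - z) + (1 * (1 / b\<^sup>2 * norm (y - z)) + 1 / (1 + b)\<^sup>2 * norm (y - z))"
  proof (intro add_mono mult_mono)
    show "\<bar>?p\<bar> \<le> 1 / m\<^sup>2 * norm (y - z)"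
      using inverse_max_lipschitz[OF assms(2), of "snd z" "snd y"] mult_left_mono[OF s, of "1 / m\<^sup>2"]
      by (simp add: abs_minus_commute)
    show "\<bar>?q\<bar> \<le> 1 / b\<^sup>2 * norm (y - z)"
      using inverse_max_lipschitz[OF assms(3), of "fst y" "fst z"] mult_left_mono[OF f, of "1 / b\<^sup>2"]
      by simp
    show "\<bar>?r\<bar> \<le> 1 / (1 + b)\<^sup>2 * norm (y - z)"
      using inverse_max_lipschitz[of "1 + b" "1 + fst y" "1 + fst z"] mult_left_mono[OF f, of "1 / (1 + b)\<^sup>2"] assms(3)
      by simp
  qed auto
  also have "\<dots> = (1 / m\<^sup>2 + 1 / b\<^sup>2 + 1 / (1 + b)\<^sup>2) * norm (y - z)"
    by (simp add: distrib_right)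
  finally show ?thesis .
qed

lemma shoot_rhs_bound:
  assumes "\<gamma> \<in> M_ac" "m > 0" "b > 0" "t \<in> {0..1}"
  shows "norm (shoot_rhs \<gamma> m b t y) \<le> 1 / m + (1 / b + 1 / (1 + b))"
proof -
  have *: "\<bar>1 / max x c\<bar> \<le> 1 / c" if "c > 0" for x c :: real
    using that by (simp add: frac_le less_max_iff_disj)
  have "norm (shoot_rhs \<gamma> m b t y)
      \<le> \<bar>1 / max (snd y) m\<bar> + \<bar>(1 - \<gamma> t) * (1 / max (fst y) b) + 1 / max (1 + fst y) (1 + b)\<bar>"
    using norm_Pair_le[of "- (1 / max (snd y) m)"
        "(1 - \<gamma> t) * (1 / max (fst y) b) + 1 / max (1 + fst y) (1 + b)"]
    by (simp add: shoot_rhs_def)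
  also have "\<dots> \<le> \<bar>1 / max (snd y) m\<bar> + (\<bar>1 - \<gamma> t\<bar> * \<bar>1 / max (fst y) b\<bar> + \<bar>1 / max (1 + fst y) (1 + b)\<bar>)"
    using abs_triangle_ineq[of "(1 - \<gamma> t) * (1 / max (fst y) b)" "1 / max (1 + fst y) (1 + b)"]
    by (simp only: abs_mult add_left_mono)
  also have "\<dots> \<le> 1 / m + (1 * (1 / b) + 1 / (1 + b))"
    using M_ac_range[OF assms(1,4)] assms by (intro add_mono mult_mono *) auto
  finally show ?thesis by simp
qed

lemma shoot_rhs_measurable:
  assumes "\<gamma> \<in> M_ac" "y \<in> borel_measurable (restrict_space borel {0..1})"
  shows "(\<lambda>t. shoot_rhs \<gamma> m b t (y t)) \<in> borel_measurable (restrict_space borel {0..1})"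
proof -
  have [measurable]: "\<gamma> \<in> borel_measurable (restrict_space borel {0..1})"
    using assms(1) by (simp add: M_ac_def)
  have [measurable]: "(\<lambda>t. fst (y t)) \<in> borel_measurable (restrict_space borel {0..1})"
    "(\<lambda>t. snd (y t)) \<in> borel_measurable (restrict_space borel {0..1})"
    using measurable_compose[OF assms(2), of fst borel] measurable_compose[OF assms(2), of snd borel]
    by (simp_all flip: borel_prod)
  show ?thesis unfolding shoot_rhs_def by measurable
qed

lemma bdd_measurable_fst:
  assumes "bdd_measurable f" shows "bdd_measurable (\<lambda>t. fst (f t))"
proof -
  obtain M where "\<And>x. x \<in> {0..1} \<Longrightarrow> norm (f x) \<le> M" using bdd_measurable_bound[OF assms] by blast
  then show ?thesis
    using measurable_compose[OF bdd_measurable_measurable[OF assms], of fst borel] norm_fst_snd_le(1)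
    by (intro bdd_measurableI[of _ M]) (auto simp flip: borel_prod intro: order_trans[OF norm_fst_snd_le(1)] order_trans[OF norm_fst_snd_le(2)])
qed

lemma bdd_measurable_snd:
  assumes "bdd_measurable f" shows "bdd_measurable (\<lambda>t. snd (f t))"
proof -
  obtain M where "\<And>x. x \<in> {0..1} \<Longrightarrow> norm (f x) \<le> M" using bdd_measurable_bound[OF assms] by blast
  then show ?thesis
    using measurable_compose[OF bdd_measurable_measurable[OF assms], of snd borel] norm_fst_snd_le(2)
    by (intro bdd_measurableI[of _ M]) (auto simp flip: borel_prod intro: order_trans[OF norm_fst_snd_le(1)] order_trans[OF norm_fst_snd_le(2)])
qed

text \<open>Because the cutoffs do not depend on the initial value \<open>p\<close>, all
  trajectories belong to one globally Lipschitz field, and one constant \<open>C\<close> serves for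
  all pairs \<open>p\<close>, \<open>q\<close>.\<close>

lemma shoot_solution:
  assumes \<gamma>: "\<gamma> \<in> M_ac" and m: "m > 0" and b: "b > 0"
  obtains y where
    "\<And>p. bdd_measurable (\<lambda>t. shoot_rhs \<gamma> m b t (y p t))"
    "\<And>p x. x \<in> {0..1} \<Longrightarrow> y p x = p + integral {0..x} (\<lambda>t. shoot_rhs \<gamma> m b t (y p t))"
    "\<exists>C. \<forall>p q. \<forall>x\<in>{0..1}. dist (y p x) (y q x) \<le> C * dist p q"
proof -
  define L where "L = 1 / m\<^sup>2 + 1 / b\<^sup>2 + 1 / (1 + b)\<^sup>2"
  have L: "L > 0" unfolding L_def using m b by (intro add_pos_pos) auto
  have "\<exists>y. bdd_measurable (\<lambda>t. shoot_rhs \<gamma> m b t (y t)) \<and>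
      (\<forall>x\<in>{0..1}. y x = p + integral {0..x} (\<lambda>t. shoot_rhs \<gamma> m b t (y t)))" for p
    by (rule caratheodory_existence[OF shoot_rhs_measurable[OF \<gamma>] shoot_rhs_bound[OF \<gamma> m b]
          shoot_rhs_lipschitz[OF \<gamma> m b] L[unfolded L_def]])
  then obtain y where y: "\<And>p. bdd_measurable (\<lambda>t. shoot_rhs \<gamma> m b t (y p t))"
    "\<And>p x. x \<in> {0..1} \<Longrightarrow> y p x = p + integral {0..x} (\<lambda>t. shoot_rhs \<gamma> m b t (y p t))"
    by metis
  have "dist (y p x) (y q x) \<le> (2 * exp (2 * L)) * dist p q" if "x \<in> {0..1}" for p q x
    unfolding dist_norm
    by (rule caratheodory_dependence[OF shoot_rhs_lipschitz[OF \<gamma> m b, folded L_def] L y(1) y(2) y(1) y(2) that])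
  then show thesis using that[OF y] by blast
qed

text \<open>The parameter \<open>a\<close> is \<open>F 0\<close>, and the initial value of \<theta>
  encodes the left boundary condition. Since \<open>F' = 1 / (\<theta> * (1 + v)^2)\<close>, the
  last conclusion is the right boundary condition. The conclusions are free of cutoffs because these
  turn out to be inactive at the chosen parameter.\<close>

lemma shooting:
  assumes c: "0 < \<alpha>" "\<alpha> < \<beta>" "\<beta> < 1" "A > 0" "B > 0" and \<gamma>: "\<gamma> \<in> M_ac"
  obtains a v \<theta> where
    "\<alpha> < a" "v 0 = 1 / a - 1" "\<theta> 0 = A * a\<^sup>2 / (a - \<alpha>)"
    "primitive v (\<lambda>x. - 1 / \<theta> x)"
    "primitive \<theta> (\<lambda>x. (1 - \<gamma> x) / v x + 1 / (1 + v x))"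
    "\<And>x. x \<in> {0..1} \<Longrightarrow> \<theta> x > 0 \<and> 1 / \<beta> - 1 < v x \<and> v x \<le> v 0"
    "B / (\<theta> 1 * (1 + v 1)\<^sup>2) = \<beta> - 1 / (1 + v 1)"
proof -
  define b where "b = 1 / \<beta> - 1"
  \<comment> \<open>The smallest numerator of \<open>\<theta>0 a\<close> over its largest
    denominator for \<open>\<alpha> < a \<le> \<beta>\<close>: one cutoff for all shooting
    parameters.\<close>
  define m where "m = A * \<alpha>\<^sup>2 / (\<beta> - \<alpha>)"
  define \<theta>0 where "\<theta>0 a = A * a\<^sup>2 / (a - \<alpha>)" for a
  have b: "b > 0" "1 + b = 1 / \<beta>" using c by (auto simp: b_def field_simps)
  have m: "m > 0" using c by (simp add: m_def)
  have \<theta>0: "m \<le> \<theta>0 a" if "\<alpha> < a" "a \<le> \<beta>" for a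
    unfolding m_def \<theta>0_def using c that
    by (intro frac_le mult_left_mono power_mono) auto
  obtain y where y: "\<And>p. bdd_measurable (\<lambda>t. shoot_rhs \<gamma> m b t (y p t))"
    "\<And>p x. x \<in> {0..1} \<Longrightarrow> y p x = p + integral {0..x} (\<lambda>t. shoot_rhs \<gamma> m b t (y p t))"
    "\<exists>C. \<forall>p q. \<forall>x\<in>{0..1}. dist (y p x) (y q x) \<le> C * dist p q"
    by (rule shoot_solution[OF \<gamma> m b(1)], rule that)
  define V where "V a x = fst (y (1 / a - 1, \<theta>0 a) x)" for a x
  define \<Theta> where "\<Theta> a x = snd (y (1 / a - 1, \<theta>0 a) x)" for a x
  have V: "primitive (V a) (\<lambda>x. - 1 / max (\<Theta> a x) m)" and V0: "V a 0 = 1 / a - 1"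
    and T: "primitive (\<Theta> a) (\<lambda>x. (1 - \<gamma> x) / max (V a x) b + 1 / max (1 + V a x) (1 + b))"
    and T0: "\<Theta> a 0 = \<theta>0 a" for a
  proof -
    let ?p = "(1 / a - 1, \<theta>0 a)"
    note i = bdd_measurable_integrable_on[OF y(1)[of ?p], of 0]
    have f: "fst (integral {0..x} (\<lambda>t. shoot_rhs \<gamma> m b t (y ?p t)))
        = integral {0..x} (\<lambda>t. fst (shoot_rhs \<gamma> m b t (y ?p t)))" if "x \<in> {0..1}" for x
      using integral_linear[OF i[of x] bounded_linear_fst] that by (simp add: o_def)
    have s: "snd (integral {0..x} (\<lambda>t. shoot_rhs \<gamma> m b t (y ?p t)))
        = integral {0..x} (\<lambda>t. snd (shoot_rhs \<gamma> m b t (y ?p t)))" if "x \<in> {0..1}" for x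
      using integral_linear[OF i[of x] bounded_linear_snd] that by (simp add: o_def)
    have "primitive (V a) (\<lambda>t. fst (shoot_rhs \<gamma> m b t (y ?p t)))"
    proof (rule primitiveI)
      fix x :: real assume x: "x \<in> {0..1}"
      show "V a x = (1 / a - 1) + integral {0..x} (\<lambda>t. fst (shoot_rhs \<gamma> m b t (y ?p t)))"
        unfolding V_def f[OF x, symmetric] by (subst y(2)[OF x]) simp
    qed (rule bdd_measurable_fst[OF y(1)])
    then show "primitive (V a) (\<lambda>x. - 1 / max (\<Theta> a x) m)"
      by (simp add: shoot_rhs_def \<Theta>_def)
    have "primitive (\<Theta> a) (\<lambda>t. snd (shoot_rhs \<gamma> m b t (y ?p t)))"
    proof (rule primitiveI)
      fix x :: real assume x: "x \<in> {0..1}"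
      show "\<Theta> a x = \<theta>0 a + integral {0..x} (\<lambda>t. snd (shoot_rhs \<gamma> m b t (y ?p t)))"
        unfolding \<Theta>_def s[OF x, symmetric] by (subst y(2)[OF x]) simp
    qed (rule bdd_measurable_snd[OF y(1)])
    then show "primitive (\<Theta> a) (\<lambda>x. (1 - \<gamma> x) / max (V a x) b + 1 / max (1 + V a x) (1 + b))"
      by (simp add: shoot_rhs_def V_def)
    show "V a 0 = 1 / a - 1" "\<Theta> a 0 = \<theta>0 a"
      using y(2)[of 0 ?p] by (simp_all add: V_def \<Theta>_def)
  qed
  \<comment> \<open>The right-hand side for \<open>\<Theta>\<close> is nonnegative, so the cutoff at
    \<open>m\<close> is never active for admissible \<open>a\<close>.\<close>
  have Tge: "\<Theta> a x \<ge> \<theta>0 a" if x: "x \<in> {0..1}" for a x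
  proof -
    have "0 \<le> \<Theta> a x - \<Theta> a 0"
    proof (rule has_integral_nonneg[OF primitive_diff[OF T]])
      fix t assume "t \<in> {0..x}"
      then have "0 \<le> \<gamma> t \<and> \<gamma> t \<le> 1" using M_ac_range[OF \<gamma>, of t] x by auto
      then show "0 \<le> (1 - \<gamma> t) / max (V a t) b + 1 / max (1 + V a t) (1 + b)"
        using b(1) by (intro add_nonneg_nonneg divide_nonneg_nonneg) (auto simp: le_max_iff_disj)
    qed (use x in auto)
    then show ?thesis by (simp add: T0)
  qed
  have V': "primitive (V a) (\<lambda>x. - 1 / \<Theta> a x)" if a: "\<alpha> < a" "a \<le> \<beta>" for a
  proof (rule primitive_cong[OF V refl])
    fix x :: real assume "x \<in> {0..1}"
    then have "max (\<Theta> a x) m = \<Theta> a x" using Tge[of x a] \<theta>0[OF a] by linarith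
    then show "- 1 / max (\<Theta> a x) m = - 1 / \<Theta> a x" by simp
  qed
  have Tpos: "\<Theta> a x > 0" if "\<alpha> < a" "a \<le> \<beta>" "x \<in> {0..1}" for a x
    using \<theta>0[OF that(1,2)] Tge[OF that(3), of a] m by linarith
  have Vmono: "V a z \<le> V a x" if a: "\<alpha> < a" "a \<le> \<beta>" and xz: "0 \<le> x" "x \<le> z" "z \<le> 1" for a x z
  proof -
    have "V a z - V a x \<le> 0"
    proof (rule has_integral_le[OF primitive_diff[OF V'[OF a] xz] has_integral_0])
      fix t assume "t \<in> {x..z}"
      then show "- 1 / \<Theta> a t \<le> 0" using Tpos[OF a, of t] xz by simp
    qed
    then show ?thesis by simp
  qed
  have Vlow: "V a 1 \<ge> 1 / a - 1 - 1 / \<theta>0 a" if a: "\<alpha> < a" "a \<le> \<beta>" for a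
  proof -
    have pos: "\<theta>0 a > 0" using \<theta>0[OF a] m by simp
    have "- 1 / \<theta>0 a * (1 - 0) \<le> V a 1 - V a 0"
    proof (rule has_integral_le[OF _ primitive_diff[OF V'[OF a]]])
      show "((\<lambda>_. - 1 / \<theta>0 a) has_integral - 1 / \<theta>0 a * (1 - 0)) {0..1::real}"
        using has_integral_const_real[of "- 1 / \<theta>0 a" "0::real" 1] by simp
      fix t :: real assume "t \<in> {0..1}"
      then show "- 1 / \<theta>0 a \<le> - 1 / \<Theta> a t"
        using Tge[of t a] pos by (simp add: frac_le)
    qed auto
    then show ?thesis by (simp add: V0)
  qed
  \<comment> \<open>\<open>H\<close> is the defect \<open>B * F' 1 - (\<beta> - F 1)\<close> of the
    right boundary condition. Clipping at \<open>b\<close> gives it a meaning also for trajectories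
    on which \<open>F\<close> would exceed \<beta>.\<close>
  define w where "w a = max (V a 1) b" for a
  define H where "H a = B / (\<Theta> a 1 * (1 + w a)\<^sup>2) - (\<beta> - 1 / (1 + w a))" for a
  have wb: "w a \<ge> b" for a by (simp add: w_def)
  \<comment> \<open>A trajectory starting at \<beta> ends clipped, so
    \<open>\<beta> - 1 / (1 + w \<beta>)\<close> vanishes and only the positive slope term
    remains.\<close>
  have "H \<beta> > 0"
  proof -
    have "\<theta>0 \<beta> > 0" using \<theta>0[of \<beta>] m c by simp
    moreover have "V \<beta> 1 \<le> b" using Vmono[of \<beta> 0 1] c V0[of \<beta>] by (simp add: b_def)
    then have "w \<beta> = b" by (simp add: w_def)
    ultimately show ?thesis
      using Tge[of 1 \<beta>] b c by (simp add: H_def)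
  qed
  \<comment> \<open>For \<open>a\<close> close to \<alpha> the initial slope is small, and
    \<open>F 1\<close> falls short of \<beta>. Below, \<open>h a\<close> is
    \<open>1 / \<theta>0 a\<close>, which bounds the total fall of \<open>v\<close>; the product
    that is compared with 1 tends to \<open>\<beta> / \<alpha> > 1\<close>.\<close>
  moreover obtain a1 where a1: "\<alpha> < a1" "a1 < \<beta>" "H a1 < 0"
  proof -
    define h where "h a = (a - \<alpha>) / (A * a\<^sup>2)" for a
    have t1: "((\<lambda>a. (1 / a - h a) * (\<beta> - B * h a)) \<longlongrightarrow> (1 / \<alpha> - h \<alpha>) * (\<beta> - B * h \<alpha>)) (at_right \<alpha>)"
      and t2: "((\<lambda>a. \<beta> - B * h a) \<longlongrightarrow> \<beta> - B * h \<alpha>) (at_right \<alpha>)"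
      unfolding h_def using c by (auto intro!: tendsto_eq_intros)
    have "h \<alpha> = 0" by (simp add: h_def)
    then have "1 < (1 / \<alpha> - h \<alpha>) * (\<beta> - B * h \<alpha>)" "0 < \<beta> - B * h \<alpha>" using c by auto
    from order_tendstoD(1)[OF t1 this(1)] order_tendstoD(1)[OF t2 this(2)]
    have "\<forall>\<^sub>F a in at_right \<alpha>. 1 < (1 / a - h a) * (\<beta> - B * h a)"
      and "\<forall>\<^sub>F a in at_right \<alpha>. 0 < \<beta> - B * h a" .
    moreover have "\<forall>\<^sub>F a in at_right \<alpha>. a \<in> {\<alpha><..<\<beta>}"
      using c by (intro eventually_at_right_real) auto
    ultimately have "\<forall>\<^sub>F a in at_right \<alpha>. 1 < (1 / a - h a) * (\<beta> - B * h a) \<and> 0 < \<beta> - B * h a \<and> a \<in> {\<alpha><..<\<beta>}"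
      by eventually_elim auto
    then obtain a where a: "1 < (1 / a - h a) * (\<beta> - B * h a)" "0 < \<beta> - B * h a" "\<alpha> < a" "a < \<beta>"
      using eventually_happens'[OF trivial_limit_at_right_real] by fastforce
    have h: "1 / \<theta>0 a = h a" by (simp add: h_def \<theta>0_def)
    have "\<theta>0 a > 0" using \<theta>0[of a] a m by simp
    have "1 / a - h a \<le> 1 + w a"
      using Vlow[of a] a by (simp add: h w_def)
    then have "(1 / a - h a) * (\<beta> - B * h a) \<le> (1 + w a) * (\<beta> - B * h a)"
      using a by (intro mult_right_mono) auto
    then have "1 < (1 + w a) * (\<beta> - B * h a)" using a by linarith
    then have 1: "1 / (1 + w a) < \<beta> - B * h a"
      using wb[of a] b by (simp add: divide_less_eq mult.commute)
    have "B / (\<Theta> a 1 * (1 + w a)\<^sup>2) \<le> B / (\<theta>0 a * 1)"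
      using wb[of a] b c \<open>\<theta>0 a > 0\<close> Tge[of 1 a]
      by (intro divide_left_mono mult_mono mult_pos_pos) (auto simp: one_le_power)
    also have "\<dots> = B * h a" using h[symmetric] by simp
    finally have "H a < 0" unfolding H_def using 1 by linarith
    then show thesis using that a by blast
  qed
  moreover have "continuous_on {a1..\<beta>} H"
  proof -
    have \<theta>c: "continuous_on {a1..\<beta>} (\<lambda>a. (1 / a - 1, \<theta>0 a))"
      unfolding \<theta>0_def using a1 c by (intro continuous_intros) auto
    obtain C where C: "\<And>p q x. x \<in> {0..1} \<Longrightarrow> dist (y p x) (y q x) \<le> C * dist p q"
      using y(3) by blast
    have "continuous_on UNIV (\<lambda>p. y p 1)"
      unfolding continuous_on_def
    proof
      fix p :: "real \<times> real"
      have "((\<lambda>q. C * dist q p) \<longlongrightarrow> C * dist p p) (at p)"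
        by (intro tendsto_intros)
      then have lim: "((\<lambda>q. C * dist q p) \<longlongrightarrow> 0) (at p)" by simp
      have "norm (dist (y q 1) (y p 1)) \<le> C * dist q p" for q
        unfolding real_norm_def abs_of_nonneg[OF zero_le_dist] by (rule C) simp
      then have "((\<lambda>q. dist (y q 1) (y p 1)) \<longlongrightarrow> 0) (at p)"
        by (intro Lim_null_comparison[OF always_eventually lim] allI)
      then show "((\<lambda>q. y q 1) \<longlongrightarrow> y p 1) (at p within UNIV)"
        by (rule tendsto_dist_iff[THEN iffD2])
    qed
    then have "continuous_on {a1..\<beta>} (\<lambda>a. y (1 / a - 1, \<theta>0 a) 1)"
      by (rule continuous_on_compose2[OF _ \<theta>c]) auto
    then have "continuous_on {a1..\<beta>} (\<lambda>a. V a 1)" "continuous_on {a1..\<beta>} (\<lambda>a. \<Theta> a 1)"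
      unfolding V_def \<Theta>_def by (intro continuous_intros; assumption)+
    moreover have "\<Theta> a 1 \<noteq> 0" if "a \<in> {a1..\<beta>}" for a
      using Tpos[of a 1] that a1 by auto
    moreover have "1 + w a \<noteq> 0" for a using wb[of a] b by linarith
    ultimately show ?thesis
      unfolding H_def w_def by (intro continuous_intros) (auto simp: w_def)
  qed
  ultimately obtain a where a: "a1 \<le> a" "a \<le> \<beta>" "H a = 0"
    using IVT'[of H a1 0 \<beta>] by auto
  have a': "\<alpha> < a" "a \<le> \<beta>" using a a1 by auto
  have eq: "B / (\<Theta> a 1 * (1 + w a)\<^sup>2) = \<beta> - 1 / (1 + w a)" using a(3) by (simp add: H_def)
  \<comment> \<open>At a zero of \<open>H\<close> the positive slope term forces
    \<open>1 / (1 + w a) < \<beta>\<close>, so the clip is inactive at 1. Since \<open>V a\<close>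
    decreases, \<open>b\<close> is not reached anywhere on the interval.\<close>
  moreover have "B / (\<Theta> a 1 * (1 + w a)\<^sup>2) > 0"
    using Tpos[OF a', of 1] wb[of a] b c by (intro divide_pos_pos mult_pos_pos) auto
  ultimately have "1 / (1 + w a) < 1 / (1 + b)" using b c by simp
  then have "w a > b" using wb[of a] b by (metis less_irrefl order_le_less)
  then have w: "w a = V a 1" "V a 1 > b" by (auto simp: w_def max_def split: if_splits)
  have Vb: "b < V a x" if "x \<in> {0..1}" for x
    using Vmono[OF a', of x 1] w that by auto
  show thesis
  proof (rule that[of a "V a" "\<Theta> a"])
    show "primitive (\<Theta> a) (\<lambda>x. (1 - \<gamma> x) / V a x + 1 / (1 + V a x))"
    proof (rule primitive_cong[OF T refl])
      fix x :: real assume "x \<in> {0..1}"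
      then have "max (V a x) b = V a x" "max (1 + V a x) (1 + b) = 1 + V a x"
        using Vb[of x] by auto
      then show "(1 - \<gamma> x) / max (V a x) b + 1 / max (1 + V a x) (1 + b)
          = (1 - \<gamma> x) / V a x + 1 / (1 + V a x)"
        by simp
    qed
    show "\<Theta> a x > 0 \<and> 1 / \<beta> - 1 < V a x \<and> V a x \<le> V a 0" if "x \<in> {0..1}" for x
      using Vb[OF that] Tpos[OF a' that] Vmono[OF a', of 0 x] that by (auto simp: b_def)
    show "B / (\<Theta> a 1 * (1 + V a 1)\<^sup>2) = \<beta> - 1 / (1 + V a 1)" using eq w by simp
  qed (use a' V0 T0 V' \<theta>0_def in auto)
qed

text \<open>This is \<open>(1 / F')' = - R * (1 / F')\<close> in the shooting variables:
  \<open>\<theta> * (1 + v)^2\<close> is \<open>1 / F'\<close>, the last fraction is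
  \<open>R\<close>, and \<open>g\<close> stands for the value of \<gamma>. The left side has the
  shape in which the product rule delivers it.\<close>

lemma shoot_identity:
  fixes v \<theta> g :: real
  assumes "v > 0" "\<theta> > 0"
  shows "((1 - g) / v + 1 / (1 + v)) * ((1 + v) * (1 + v))
      + \<theta> * (- 1 / \<theta> * (1 + v) + (1 + v) * (- 1 / \<theta>))
    = - (\<theta> * ((1 + v) * (1 + v)) * ((g - 1 / (1 + v)) / (\<theta> * v)))"
proof -
  have "((1 - g) / v + 1 / (1 + v)) * ((1 + v) * (1 + v)) = (1 - g) * (1 + v) * (1 + v) / v + (1 + v)"
    unfolding distrib_right[of "(1 - g) / v"] using assms by (simp add: mult.assoc)
  moreover have "\<theta> * (- 1 / \<theta> * (1 + v) + (1 + v) * (- 1 / \<theta>)) = - 2 * (1 + v)"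
    using assms by (simp add: field_simps)
  moreover have "\<theta> * ((1 + v) * (1 + v)) * ((g - 1 / (1 + v)) / (\<theta> * v)) = (g * (1 + v) - 1) * (1 + v) / v"
  proof -
    have "(1 + v) * (g - 1 / (1 + v)) = g * (1 + v) - 1"
      using assms by (simp add: right_diff_distrib mult.commute)
    moreover have "\<theta> * ((1 + v) * (1 + v)) * ((g - 1 / (1 + v)) / (\<theta> * v))
        = ((1 + v) * (g - 1 / (1 + v))) * (1 + v) / v"
      using assms by simp
    ultimately show ?thesis by (simp only:)
  qed
  moreover have "(1 - g) * (1 + v) * (1 + v) / v + (1 + v) + - 2 * (1 + v) = - ((g * (1 + v) - 1) * (1 + v) / v)"
    using assms by (simp add: divide_simps algebra_simps)
  ultimately show ?thesis by simp
qed

lemma bvp_exists: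
  assumes c: "0 < \<alpha>" "\<alpha> < \<beta>" "\<beta> < 1" "A > 0" "B > 0" and \<gamma>: "\<gamma> \<in> M_ac"
  shows "\<exists>F. solves_bvp \<alpha> \<beta> A B \<gamma> F"
proof -
  obtain a v \<theta> where s: "\<alpha> < a" "v 0 = 1 / a - 1" "\<theta> 0 = A * a\<^sup>2 / (a - \<alpha>)"
    "primitive v (\<lambda>x. - 1 / \<theta> x)"
    "primitive \<theta> (\<lambda>x. (1 - \<gamma> x) / v x + 1 / (1 + v x))"
    "\<And>x. x \<in> {0..1} \<Longrightarrow> \<theta> x > 0 \<and> 1 / \<beta> - 1 < v x \<and> v x \<le> v 0"
    "B / (\<theta> 1 * (1 + v 1)\<^sup>2) = \<beta> - 1 / (1 + v 1)"
    using shooting[OF c \<gamma>] by blast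
  have b: "1 / \<beta> > 1" using c by simp
  have vpos: "v x > 0" "1 + v x > 0" if "x \<in> {0..1}" for x
    using s(6)[OF that] b by auto
  have \<theta>pos: "\<theta> x > 0" if "x \<in> {0..1}" for x using s(6)[OF that] by simp
  have ne: "\<forall>x\<in>{0..1}. \<theta> x \<noteq> 0" "\<forall>x\<in>{0..1}. 1 + v x \<noteq> 0"
    by (intro ballI less_imp_neq[THEN not_sym] \<theta>pos vpos(2); assumption)+
  define F where "F = restrict (\<lambda>x. 1 / (1 + v x)) {0..1}"
  define D where "D x = 1 / (\<theta> x * (1 + v x)\<^sup>2)" for x
  have F: "F x = 1 / (1 + v x)" if "x \<in> {0..1}" for x using that by (simp add: F_def)
  have vd: "(v has_real_derivative - 1 / \<theta> x) (at x within {0..1})" if x: "x \<in> {0..1}" for x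
    using ne(1) by (intro primitive_deriv[OF s(4) _ x] continuous_intros primitive_continuous_on[OF s(5)])
  have Fd: "(F has_real_derivative D x) (at x within {0..1})" if x: "x \<in> {0..1}" for x
  proof -
    have "((\<lambda>x. 1 / (1 + v x)) has_real_derivative D x) (at x within {0..1})"
      using vpos[OF x] \<theta>pos[OF x]
      by (auto intro!: derivative_eq_intros vd[OF x] simp: D_def power2_eq_square)
    then show ?thesis
      by (rule has_field_derivative_transform_within[where d = 1]) (use x F in auto)
  qed
  have nab: "nabla F x = D x" if "x \<in> {0..1}" for x by (rule nabla_eqI[OF Fd[OF that] that])
  have Dc: "continuous_on {0..1} D"
    unfolding D_def using ne
    by (intro continuous_intros primitive_continuous_on[OF s(5)] primitive_continuous_on[OF s(4)]) auto
  have FF: "F \<in> F_set \<alpha> \<beta>"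
    unfolding F_set_def
  proof (intro CollectI conjI ballI)
    show "F \<in> extensional {0..1}" by (simp add: F_def)
    show "F differentiable_on {0..1}"
      using Fd unfolding differentiable_on_def real_differentiable_def by blast
    show "continuous_on {0..1} (nabla F)" by (rule continuous_on_eq[OF Dc]) (simp add: nab)
    fix x :: real assume x: "x \<in> {0..1}"
    \<comment> \<open>As \<open>v\<close> never exceeds its initial value, \<open>F\<close> stays at
      or above \<open>F 0 = a > \<alpha>\<close>.\<close>
    have "1 + v x < 1 / \<alpha>"
    proof -
      have "1 / a < 1 / \<alpha>" using s(1) c by (intro divide_strict_left_mono) auto
      then show ?thesis using s(2) s(6)[OF x] by linarith
    qed
    then have "(1 + v x) * \<alpha> < 1" using c by (simp add: pos_less_divide_eq)
    then show "\<alpha> < F x" using vpos[OF x] by (simp add: F[OF x] pos_less_divide_eq mult.commute)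
    have "1 / \<beta> < 1 + v x" using s(6)[OF x] by linarith
    then have "1 < (1 + v x) * \<beta>" using c by (simp add: pos_divide_less_eq)
    then show "F x < \<beta>" using vpos[OF x] by (simp add: F[OF x] pos_divide_less_eq mult.commute)
    show "0 < nabla F x" using vpos[OF x] \<theta>pos[OF x] nab[OF x] by (simp add: D_def)
  qed
  have bmR: "bdd_measurable (R_fun \<gamma> F)" by (rule R_fun_bdd_measurable[OF \<gamma> FF]) (use c in auto)
  define E where "E x = exp (integral {0..x} (R_fun \<gamma> F))" for x
  have E0: "E 0 = 1" by (simp add: E_def)
  have pE: "primitive E (\<lambda>x. E x * R_fun \<gamma> F x)"
    unfolding E_def using primitive_exp[OF primitive_integral[OF bmR, where c = 0]] by simp
  have p1: "primitive (\<lambda>x. 1 + v x) (\<lambda>x. - 1 / \<theta> x)"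
    using primitive_add[OF primitive_const[of 1] s(4)] by simp
  note pq = primitive_mult[OF primitive_mult[OF s(5) primitive_mult[OF p1 p1]] pE]
  \<comment> \<open>The constant quantity is \<open>E / F'\<close>; its derivative vanishes by
    \<open>shoot_identity\<close>. This is the exponential formula for
    \<open>nabla F\<close>.\<close>
  have inv: "\<theta> x * ((1 + v x) * (1 + v x)) * E x = \<theta> 0 * ((1 + v 0) * (1 + v 0)) * E 0"
    if "x \<in> {0..1}" for x
  proof (rule primitive_zero_const[OF pq _ that])
    fix t :: real assume t: "t \<in> {0..1}"
    have R: "R_fun \<gamma> F t = (\<gamma> t - 1 / (1 + v t)) / (\<theta> t * v t)"
    proof -
      have "F t * (1 - F t) = v t / (1 + v t)\<^sup>2"
      proof -
        have "1 - F t = v t / (1 + v t)" using vpos[OF t] by (simp add: F[OF t] field_simps)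
        then show ?thesis unfolding F[OF t] by (simp add: power2_eq_square)
      qed
      then have "D t / (F t * (1 - F t)) = 1 / (\<theta> t * v t)"
        using vpos[OF t] \<theta>pos[OF t] by (simp add: D_def)
      then show ?thesis unfolding R_fun_def nab[OF t] F[OF t, symmetric] by simp
    qed
    have zero: "L = - (Q * r) \<Longrightarrow> L * e + Q * (e * r) = 0" for L Q r e :: real
      by simp
    show "(((1 - \<gamma> t) / v t + 1 / (1 + v t)) * ((1 + v t) * (1 + v t)) +
          \<theta> t * (- 1 / \<theta> t * (1 + v t) + (1 + v t) * (- 1 / \<theta> t))) * E t +
          \<theta> t * ((1 + v t) * (1 + v t)) * (E t * R_fun \<gamma> F t) = 0"
      unfolding R by (rule zero[OF shoot_identity[OF vpos(1)[OF t] \<theta>pos[OF t]]])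
  qed
  have DE: "D x = D 0 * E x" if x: "x \<in> {0..1}" for x
  proof -
    have "\<theta> x * (1 + v x)\<^sup>2 * E x = \<theta> 0 * (1 + v 0)\<^sup>2"
      using inv[OF x] E0 by (simp add: power2_eq_square)
    then have "D 0 = 1 / (\<theta> x * (1 + v x)\<^sup>2 * E x)" by (simp add: D_def)
    then show ?thesis by (simp add: D_def E_def)
  qed
  have nE: "nabla F x = nabla F 0 * E x" if "x \<in> {0..1}" for x
    using nab[OF that] nab[of 0] DE[OF that] by simp
  have "F 0 - \<alpha> = A * nabla F 0"
  proof -
    have "1 + v 0 = 1 / a" "F 0 = a" using s(2) F[of 0] by auto
    then have "nabla F 0 = (a - \<alpha>) / A"
      using s(1,3) c nab[of 0] by (simp add: D_def power_divide)
    then show ?thesis using \<open>F 0 = a\<close> c by simp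
  qed
  moreover have "\<beta> - F 1 = B * nabla F 1" using s(7) F[of 1] nab[of 1] by (simp add: D_def)
  ultimately have "solves_bvp \<alpha> \<beta> A B \<gamma> F"
    unfolding solves_bvp_iff[OF c \<gamma>] using FF nE unfolding E_def by blast
  then show ?thesis by blast
qed

section \<open>Optimality and uniqueness of the solution\<close>

definition neg_entropy :: "real \<Rightarrow> real" where "neg_entropy g = g * ln g + (1 - g) * ln (1 - g)"

definition logit :: "real \<Rightarrow> real" where "logit u = ln u - ln (1 - u)"

text \<open>The relative entropy of Bernoulli laws with parameters \<open>u\<close> and
  \<open>v\<close>. At \<open>u = 0\<close> and \<open>u = 1\<close> a vanishing factor makes the
  default value of \<open>ln 0\<close> harmless.\<close>

definition rel_entropy :: "real \<Rightarrow> real \<Rightarrow> real" where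
  "rel_entropy u v = u * (ln u - ln v) + (1 - u) * (ln (1 - u) - ln (1 - v))"

text \<open>The inequality \<open>ln s \<le> s - 1\<close> at \<open>s = y / x\<close>, multiplied
  by \<open>x\<close> so that it survives \<open>x = 0\<close>. Gibbs' inequality, the lower bound
  of the entropy and the convexity of \<open>x * ln x\<close> all follow from it.\<close>

lemma mult_ln_diff_le:
  fixes x y :: real
  assumes "x \<ge> 0" "y > 0"
  shows "x * (ln y - ln x) \<le> y - x"
proof (cases "x = 0")
  case False
  then have x: "x > 0" using assms by simp
  have "x * ln (y / x) \<le> x * (y / x - 1)"
    using x assms by (intro mult_left_mono ln_le_minus_one) auto
  then show ?thesis using x assms by (simp add: ln_div right_diff_distrib)
qed (use assms in simp)

lemma rel_entropy_nonneg:
  assumes "0 \<le> u" "u \<le> 1" "0 < v" "v < 1"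
  shows "rel_entropy u v \<ge> 0"
  using mult_ln_diff_le[of u v] mult_ln_diff_le[of "1 - u" "1 - v"] assms
  by (simp add: rel_entropy_def right_diff_distrib)

text \<open>Symmetrising leaves the monotonicity form of \<open>logit\<close>, which vanishes only
  at \<open>u = v\<close> inside the unit interval; uniqueness rests on this.\<close>

lemma rel_entropy_add_swap: "rel_entropy u v + rel_entropy v u = (u - v) * (logit u - logit v)"
  by (simp add: rel_entropy_def logit_def algebra_simps)

lemma logit_less: "0 < u \<Longrightarrow> u < v \<Longrightarrow> v < 1 \<Longrightarrow> logit u < logit v"
  unfolding logit_def by (intro diff_strict_mono) auto

lemma neg_entropy_nonpos: "0 \<le> g \<Longrightarrow> g \<le> 1 \<Longrightarrow> neg_entropy g \<le> 0"
  unfolding neg_entropy_def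
  by (cases "g = 0 \<or> g = 1") (auto intro!: add_nonpos_nonpos mult_nonneg_nonpos)

text \<open>Add \<open>x * ln x \<ge> x - 1\<close> for \<open>x = g\<close> and
  \<open>x = 1 - g\<close>. The bound is cruder than the optimal \<open>- ln 2\<close>.\<close>

lemma neg_entropy_ge: "0 \<le> g \<Longrightarrow> g \<le> 1 \<Longrightarrow> - 1 \<le> neg_entropy g"
  using mult_ln_diff_le[of g 1] mult_ln_diff_le[of "1 - g" 1] by (simp add: neg_entropy_def)

lemma neg_entropy_bdd_measurable:
  assumes "\<gamma> \<in> M_ac" shows "bdd_measurable (\<lambda>x. neg_entropy (\<gamma> x))"
proof (rule bdd_measurableI[of _ 1])
  have [measurable]: "\<gamma> \<in> borel_measurable (restrict_space borel {0..1})"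
    using assms by (simp add: M_ac_def)
  show "(\<lambda>x. neg_entropy (\<gamma> x)) \<in> borel_measurable (restrict_space borel {0..1})"
    unfolding neg_entropy_def by measurable
  fix x :: real assume "x \<in> {0..1}"
  then have "0 \<le> \<gamma> x" "\<gamma> x \<le> 1" using M_ac_range[OF assms] by auto
  then show "norm (neg_entropy (\<gamma> x)) \<le> 1" using neg_entropy_ge[of "\<gamma> x"] neg_entropy_nonpos[of "\<gamma> x"] by simp
qed

text \<open>As a function of \<open>logit v\<close>, the left hand side is concave and
  \<open>u * (1 - u) / (u - a)\<close> is its slope at \<open>u\<close>.\<close>

lemma ln_diff_le_logit:
  assumes a: "0 < a" and u: "a < u" "u < 1" and v: "a < v" "v < 1"
  shows "ln (v - a) - ln (u - a) \<le> u * (1 - u) / (u - a) * (logit v - logit u)"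
proof -
  let ?X = "ln (v - a) - ln (u - a)" and ?Y = "ln (1 - v) - ln (1 - u)" and ?S = "ln v - ln u"
  have *: "ln p - ln q - (ln v - ln u) \<le> (p * u) / (q * v) - 1" if "p > 0" "q > 0" for p q
  proof -
    have "ln p - ln q - (ln v - ln u) = ln ((p * u) / (q * v))"
      using that a u v by (simp add: ln_div ln_mult)
    also have "\<dots> \<le> (p * u) / (q * v) - 1"
      using that a u v by (intro ln_le_minus_one divide_pos_pos mult_pos_pos) auto
    finally show ?thesis .
  qed
  \<comment> \<open>The weights \<open>u - a\<close> and \<open>a * (1 - u)\<close> are chosen so
    that the right-hand sides cancel:
    \<open>(v - a) * u / v + a * (1 - v) * u / v = u * (1 - a)\<close>.\<close>
  have "(u - a) * (?X - ?S) + a * (1 - u) * (?Y - ?S)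
      \<le> (u - a) * ((v - a) * u / ((u - a) * v) - 1) + a * (1 - u) * ((1 - v) * u / ((1 - u) * v) - 1)"
    using a u v by (intro add_mono mult_left_mono *) auto
  also have "\<dots> = ((v - a) * u / v - (u - a)) + (a * (1 - v) * u / v - a * (1 - u))"
    unfolding right_diff_distrib[of "u - a"] right_diff_distrib[of "a * (1 - u)"]
    using a u v by simp
  also have "\<dots> = 0"
    using a v by (simp add: field_simps)
  finally have 1: "(u - a) * (?X - ?S) + a * (1 - u) * (?Y - ?S) \<le> 0" .
  \<comment> \<open>Adding \<open>u - a\<close> times Gibbs' inequality turns the coefficients of
    \<open>?S\<close> and \<open>?Y\<close> into \<open>- u * (1 - u)\<close> and
    \<open>u * (1 - u)\<close>, so that only the difference of logits remains.\<close>
  have "(u - a) * (u * ?S + (1 - u) * ?Y) \<le> 0"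
    using rel_entropy_nonneg[of u v] a u v
    by (intro mult_nonneg_nonpos) (auto simp: rel_entropy_def algebra_simps)
  with 1 have "(u - a) * ?X \<le> u * (1 - u) * (?S - ?Y)"
    by (simp add: algebra_simps)
  then have "?X \<le> u * (1 - u) * (?S - ?Y) / (u - a)"
    using u by (simp add: pos_le_divide_eq mult.commute)
  moreover have "?S - ?Y = logit v - logit u" by (simp add: logit_def)
  ultimately show ?thesis by simp
qed

section \<open>The integrand of the functional and the Euler-Lagrange equation\<close>

definition G_integrand :: "real \<Rightarrow> real \<Rightarrow> (real \<Rightarrow> real) \<Rightarrow> (real \<Rightarrow> real) \<Rightarrow> real \<Rightarrow> real" where
  "G_integrand \<alpha> \<beta> \<gamma> F x = neg_entropy (\<gamma> x) - (\<gamma> x * ln (F x) + (1 - \<gamma> x) * ln (1 - F x))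
     + (ln (nabla F x) - ln (\<beta> - \<alpha>))"

lemma F_set_continuous_ln:
  assumes "F \<in> F_set \<alpha> \<beta>" "0 < \<alpha>" "\<beta> < 1"
  shows "continuous_on {0..1} (\<lambda>x. ln (F x))" "continuous_on {0..1} (\<lambda>x. ln (1 - F x))"
    "continuous_on {0..1} (\<lambda>x. ln (nabla F x))"
proof -
  have "\<forall>x\<in>{0..1}. 0 < F x \<and> 0 < 1 - F x \<and> 0 < nabla F x"
    using F_set_range[OF assms(1)] assms(2,3) by fastforce
  then show "continuous_on {0..1} (\<lambda>x. ln (F x))" "continuous_on {0..1} (\<lambda>x. ln (1 - F x))"
    "continuous_on {0..1} (\<lambda>x. ln (nabla F x))"
    by (auto intro!: continuous_intros F_set_continuous[OF assms(1)] F_set_nabla_continuous[OF assms(1)])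
qed

lemma G_integrand_bdd_measurable:
  assumes "\<gamma> \<in> M_ac" "F \<in> F_set \<alpha> \<beta>" "0 < \<alpha>" "\<beta> < 1"
  shows "bdd_measurable (G_integrand \<alpha> \<beta> \<gamma> F)"
  unfolding G_integrand_def
  by (intro bdd_measurable_intros neg_entropy_bdd_measurable M_ac_bdd_measurable assms bdd_measurable_continuous F_set_continuous_ln[OF assms(2-4)])

lemma G_fun_eq:
  assumes "\<gamma> \<in> M_ac" "F \<in> F_set \<alpha> \<beta>" "0 < \<alpha>" "\<alpha> < \<beta>" "\<beta> < 1" "A > 0" "B > 0"
  shows "G_fun \<alpha> \<beta> A B \<gamma> F = integral {0..1} (G_integrand \<alpha> \<beta> \<gamma> F)
    + A * (ln (F 0 - \<alpha>) - ln (A * (\<beta> - \<alpha>))) + B * (ln (\<beta> - F 1) - ln (B * (\<beta> - \<alpha>)))"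
proof -
  have "\<gamma> x * ln (\<gamma> x / F x) + (1 - \<gamma> x) * ln ((1 - \<gamma> x) / (1 - F x)) + ln (nabla F x / (\<beta> - \<alpha>))
      = G_integrand \<alpha> \<beta> \<gamma> F x" if x: "x \<in> {0..1}" for x
  proof -
    have F: "0 < F x" "F x < 1" "nabla F x > 0" using F_set_range[OF assms(2) x] assms by auto
    have "g * ln (g / f) = g * (ln g - ln f)" if "0 \<le> g" "0 < f" for g f :: real
      using that by (cases "g = 0") (auto simp: ln_div)
    from this[of "\<gamma> x" "F x"] this[of "1 - \<gamma> x" "1 - F x"] show ?thesis
      using F M_ac_range[OF assms(1) x] assms(4)
      by (simp add: G_integrand_def neg_entropy_def ln_div right_diff_distrib)
  qed
  then have "(LINT x:{0..1}|lborel. \<gamma> x * ln (\<gamma> x / F x) + (1 - \<gamma> x) * ln ((1 - \<gamma> x) / (1 - F x))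
      + ln (nabla F x / (\<beta> - \<alpha>))) = (LINT x:{0..1}|lborel. G_integrand \<alpha> \<beta> \<gamma> F x)"
    by (intro set_lebesgue_integral_cong) auto
  also have "\<dots> = integral {0..1} (G_integrand \<alpha> \<beta> \<gamma> F)"
    by (intro bdd_measurable_LINT G_integrand_bdd_measurable assms) auto
  finally show ?thesis
    using F_set_range[OF assms(2), of 0] F_set_range[OF assms(2), of 1] assms
    by (simp add: G_fun_def ln_div)
qed

lemma rel_entropy_bdd_measurable:
  assumes "F1 \<in> F_set \<alpha> \<beta>" "F2 \<in> F_set \<alpha> \<beta>" "0 < \<alpha>" "\<beta> < 1"
  shows "bdd_measurable (\<lambda>x. rel_entropy (F1 x) (F2 x))"
  unfolding rel_entropy_def
  by (intro bdd_measurable_intros bdd_measurable_continuous F_set_continuous_ln[OF assms(1,3,4)]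
      F_set_continuous_ln[OF assms(2,3,4)] F_set_continuous[OF assms(1)])

text \<open>In the variable \<open>\<phi> = logit F\<close> the functional is concave, and the equation
  says that \<open>1 / \<phi>'\<close> has derivative \<open>1 - \<gamma> - F\<close>.\<close>

lemma solves_bvp_primitive:
  assumes c: "0 < \<alpha>" "\<alpha> < \<beta>" "\<beta> < 1" "A > 0" "B > 0" and \<gamma>: "\<gamma> \<in> M_ac"
    and sol: "solves_bvp \<alpha> \<beta> A B \<gamma> F"
  shows "primitive (\<lambda>x. F x * (1 - F x) / nabla F x) (\<lambda>x. 1 - \<gamma> x - F x)"
proof -
  have F: "F \<in> F_set \<alpha> \<beta>" and n: "\<And>x. x \<in> {0..1} \<Longrightarrow> nabla F x = nabla F 0 * exp (integral {0..x} (R_fun \<gamma> F))"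
    using sol unfolding solves_bvp_iff[OF c \<gamma>] by blast+
  \<comment> \<open>\<open>W\<close> is a multiple of \<open>1 / nabla F\<close>. The exponential
    form of the equation gives it a primitive rule although \<open>nabla F\<close> need not be
    differentiable everywhere.\<close>
  define W where "W x = exp (- integral {0..x} (R_fun \<gamma> F))" for x
  define k where "k = nabla F 0"
  have k: "k > 0" using F_set_range[OF F, of 0] by (simp add: k_def)
  have W: "W x = k / nabla F x" if "x \<in> {0..1}" for x
    using n[OF that] k unfolding W_def k_def[symmetric] by (simp add: exp_minus inverse_eq_divide)
  have bmR: "bdd_measurable (R_fun \<gamma> F)" by (rule R_fun_bdd_measurable[OF \<gamma> F]) (use c in auto)
  have pW: "primitive W (\<lambda>x. W x * - R_fun \<gamma> F x)"
    unfolding W_def using primitive_exp[OF primitive_minus[OF primitive_integral[OF bmR, where c = 0]]] by simp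
  have p1: "primitive (\<lambda>x. 1 - F x) (\<lambda>x. - nabla F x)"
    using primitive_add[OF primitive_const[of 1] primitive_minus[OF F_set_primitive[OF F]]] by simp
  note p = primitive_mult[OF primitive_const[of "1 / k"] primitive_mult[OF primitive_mult[OF F_set_primitive[OF F] p1] pW]]
  show ?thesis
  proof (rule primitive_cong[OF p])
    fix x :: real assume x: "x \<in> {0..1}"
    have r: "0 < F x" "F x < 1" "nabla F x > 0" using F_set_range[OF F x] c by auto
    show "1 / k * (F x * (1 - F x) * W x) = F x * (1 - F x) / nabla F x"
      using k by (simp add: W[OF x])
    have "F x * (1 - F x) * (nabla F x / (F x * (1 - F x))) = nabla F x" using r by simp
    then have R: "F x * (1 - F x) * R_fun \<gamma> F x = (\<gamma> x - F x) * nabla F x"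
      unfolding R_fun_def by (metis mult.left_commute)
    have "(nabla F x * (1 - F x) + F x * - nabla F x) * W x + F x * (1 - F x) * (W x * - R_fun \<gamma> F x)
        = W x * (nabla F x * (1 - 2 * F x) - F x * (1 - F x) * R_fun \<gamma> F x)"
      by (simp add: algebra_simps)
    also have "\<dots> = W x * (nabla F x * (1 - 2 * F x) - (\<gamma> x - F x) * nabla F x)" by (simp only: R)
    also have "\<dots> = W x * nabla F x * (1 - \<gamma> x - F x)" by (simp add: algebra_simps)
    also have "\<dots> = k * (1 - \<gamma> x - F x)" using r by (simp add: W[OF x])
    finally show "0 * (F x * (1 - F x) * W x) + 1 / k * ((nabla F x * (1 - F x) + F x * - nabla F x) * W x
        + F x * (1 - F x) * (W x * - R_fun \<gamma> F x)) = 1 - \<gamma> x - F x"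
      using k by simp
  qed
qed

lemma logit_primitive:
  assumes "F \<in> F_set \<alpha> \<beta>" "0 < \<alpha>" "\<beta> < 1"
  shows "primitive (\<lambda>x. logit (F x)) (\<lambda>x. nabla F x / (F x * (1 - F x)))"
proof (rule primitive_C1)
  fix x :: real assume x: "x \<in> {0..1}"
  have r: "0 < F x" "F x < 1" using F_set_range[OF assms(1) x] assms by auto
  then show "((\<lambda>x. logit (F x)) has_real_derivative nabla F x / (F x * (1 - F x))) (at x within {0..1})"
    unfolding logit_def
    by (auto intro!: derivative_eq_intros F_set_deriv[OF assms(1) x] simp: divide_simps)
       (simp add: algebra_simps)
next
  have "\<forall>x\<in>{0..1}. F x * (1 - F x) \<noteq> 0"
    using F_set_range[OF assms(1)] assms(2,3) by fastforce
  then show "continuous_on {0..1} (\<lambda>x. nabla F x / (F x * (1 - F x)))"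
    by (intro continuous_intros F_set_nabla_continuous[OF assms(1)] F_set_continuous[OF assms(1)])
qed

text \<open>The tangent inequality of a concave functional at \<open>F1\<close>, with \<eta> the
  difference of the logits and \<psi> the reciprocal of the derivative of
  \<open>logit (F1 x)\<close>. By the Euler-Lagrange equation the linear term is the derivative of
  \<open>\<psi> * \<eta>\<close>, and its boundary values are matched by the tangent inequalities of
  the two boundary terms.\<close>

lemma G_fun_le_solution:
  assumes c: "0 < \<alpha>" "\<alpha> < \<beta>" "\<beta> < 1" "A > 0" "B > 0" and \<gamma>: "\<gamma> \<in> M_ac"
    and sol: "solves_bvp \<alpha> \<beta> A B \<gamma> F1" and F2: "F2 \<in> F_set \<alpha> \<beta>"
  shows "G_fun \<alpha> \<beta> A B \<gamma> F2 + integral {0..1} (\<lambda>x. rel_entropy (F1 x) (F2 x)) \<le> G_fun \<alpha> \<beta> A B \<gamma> F1"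
proof -
  have F1: "F1 \<in> F_set \<alpha> \<beta>" and b0: "F1 0 - \<alpha> = A * nabla F1 0" and b1: "\<beta> - F1 1 = B * nabla F1 1"
    using sol unfolding solves_bvp_iff[OF c \<gamma>] by blast+
  define \<psi> where "\<psi> x = F1 x * (1 - F1 x) / nabla F1 x" for x
  define \<eta> where "\<eta> x = logit (F2 x) - logit (F1 x)" for x
  define \<eta>' where "\<eta>' x = nabla F2 x / (F2 x * (1 - F2 x)) - nabla F1 x / (F1 x * (1 - F1 x))" for x
  have p\<psi>: "primitive \<psi> (\<lambda>x. 1 - \<gamma> x - F1 x)"
    unfolding \<psi>_def by (rule solves_bvp_primitive[OF c \<gamma> sol])
  have p\<eta>: "primitive \<eta> \<eta>'"
    using primitive_add[OF logit_primitive[OF F2 c(1,3)] primitive_minus[OF logit_primitive[OF F1 c(1,3)]]]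
    by (simp add: \<eta>_def[abs_def] \<eta>'_def[abs_def])
  note p = primitive_mult[OF p\<psi> p\<eta>]
  have pw: "G_integrand \<alpha> \<beta> \<gamma> F2 x + rel_entropy (F1 x) (F2 x) - G_integrand \<alpha> \<beta> \<gamma> F1 x
      \<le> (1 - \<gamma> x - F1 x) * \<eta> x + \<psi> x * \<eta>' x" if x: "x \<in> {0..1}" for x
  proof -
    have r1: "0 < F1 x" "0 < 1 - F1 x" "nabla F1 x > 0" using F_set_range[OF F1 x] c by auto
    have r2: "0 < F2 x" "0 < 1 - F2 x" "nabla F2 x > 0" using F_set_range[OF F2 x] c by auto
    \<comment> \<open>\<open>?t\<close> is the ratio of the derivatives of the two logits. The bound
      \<open>ln ?t \<le> ?t - 1\<close> is the only estimate in \<open>pw\<close>; the relative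
      entropy accounts for everything else exactly.\<close>
    let ?t = "\<psi> x * (nabla F2 x / (F2 x * (1 - F2 x)))"
    have "ln ?t \<le> ?t - 1"
      unfolding \<psi>_def using r1 r2 by (intro ln_le_minus_one mult_pos_pos divide_pos_pos)
    also have "\<dots> = \<psi> x * \<eta>' x"
      using r1 by (simp add: \<eta>'_def right_diff_distrib \<psi>_def)
    also have "ln ?t = ln (F1 x) + ln (1 - F1 x) - ln (nabla F1 x) + ln (nabla F2 x) - ln (F2 x) - ln (1 - F2 x)"
      unfolding \<psi>_def using r1 r2 by (simp add: ln_mult ln_div)
    finally show ?thesis
      unfolding G_integrand_def rel_entropy_def \<eta>_def logit_def by (simp add: algebra_simps)
  qed
  note i2 = bdd_measurable_integrable_on[OF G_integrand_bdd_measurable[OF \<gamma> F2 c(1,3)], of 0 1, simplified]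
  note i1 = bdd_measurable_integrable_on[OF G_integrand_bdd_measurable[OF \<gamma> F1 c(1,3)], of 0 1, simplified]
  note ik = bdd_measurable_integrable_on[OF rel_entropy_bdd_measurable[OF F1 F2 c(1,3)], of 0 1, simplified]
  have "integral {0..1} (G_integrand \<alpha> \<beta> \<gamma> F2) + integral {0..1} (\<lambda>x. rel_entropy (F1 x) (F2 x)) - integral {0..1} (G_integrand \<alpha> \<beta> \<gamma> F1)
      \<le> \<psi> 1 * \<eta> 1 - \<psi> 0 * \<eta> 0"
    by (rule has_integral_le[OF has_integral_diff[OF has_integral_add[OF integrable_integral[OF i2]
            integrable_integral[OF ik]] integrable_integral[OF i1]] primitive_diff[OF p, of 0 1]])
      (use pw in auto)
  \<comment> \<open>The left boundary condition cancels \<open>A\<close> and turns the slope from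
    \<open>ln_diff_le_logit\<close> into \<open>\<psi> 0\<close>.\<close>
  moreover have "A * (ln (F2 0 - \<alpha>) - ln (F1 0 - \<alpha>)) \<le> \<psi> 0 * \<eta> 0"
  proof -
    have "A * (ln (F2 0 - \<alpha>) - ln (F1 0 - \<alpha>))
        \<le> A * (F1 0 * (1 - F1 0) / (F1 0 - \<alpha>) * (logit (F2 0) - logit (F1 0)))"
      using F_set_range[OF F1, of 0] F_set_range[OF F2, of 0] c
      by (intro mult_left_mono ln_diff_le_logit) auto
    also have "\<dots> = \<psi> 0 * \<eta> 0"
      unfolding b0 \<psi>_def \<eta>_def using c by simp
    finally show ?thesis .
  qed
  moreover have "B * (ln (\<beta> - F2 1) - ln (\<beta> - F1 1)) \<le> - \<psi> 1 * \<eta> 1"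
  proof -
    \<comment> \<open>The reflection \<open>F \<mapsto> 1 - F\<close> changes the sign of the logit
      and turns the right end into the left one, with \<open>1 - \<beta>\<close> in place of
      \<alpha>.\<close>
    have "ln (1 - F2 1 - (1 - \<beta>)) - ln (1 - F1 1 - (1 - \<beta>))
        \<le> (1 - F1 1) * (1 - (1 - F1 1)) / (1 - F1 1 - (1 - \<beta>)) * (logit (1 - F2 1) - logit (1 - F1 1))"
      using F_set_range[OF F1, of 1] F_set_range[OF F2, of 1] c
      by (intro ln_diff_le_logit) auto
    moreover have "logit (1 - F2 1) - logit (1 - F1 1) = - \<eta> 1"
      by (simp add: logit_def \<eta>_def)
    ultimately have "ln (\<beta> - F2 1) - ln (\<beta> - F1 1) \<le> (1 - F1 1) * F1 1 / (\<beta> - F1 1) * (- \<eta> 1)"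
      by simp
    then have "B * (ln (\<beta> - F2 1) - ln (\<beta> - F1 1)) \<le> B * ((1 - F1 1) * F1 1 / (\<beta> - F1 1) * (- \<eta> 1))"
      using c by (intro mult_left_mono) auto
    also have "\<dots> = - \<psi> 1 * \<eta> 1"
      unfolding b1 \<psi>_def using c by (simp add: mult.commute)
    finally show ?thesis .
  qed
  ultimately show ?thesis
    unfolding G_fun_eq[OF \<gamma> F2 c] G_fun_eq[OF \<gamma> F1 c] by (simp add: right_diff_distrib)
qed

lemma G_fun_le:
  assumes c: "0 < \<alpha>" "\<alpha> < \<beta>" "\<beta> < 1" "A > 0" "B > 0" and \<gamma>: "\<gamma> \<in> M_ac"
    and sol: "solves_bvp \<alpha> \<beta> A B \<gamma> F1" and F2: "F2 \<in> F_set \<alpha> \<beta>"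
  shows "G_fun \<alpha> \<beta> A B \<gamma> F2 \<le> G_fun \<alpha> \<beta> A B \<gamma> F1"
proof -
  have F1: "F1 \<in> F_set \<alpha> \<beta>" using sol by (simp add: solves_bvp_def)
  have "0 \<le> rel_entropy (F1 x) (F2 x)" if "x \<in> {0..1}" for x
    using F_set_range[OF F1 that] F_set_range[OF F2 that] c by (intro rel_entropy_nonneg) auto
  then have "0 \<le> integral {0..1} (\<lambda>x. rel_entropy (F1 x) (F2 x))"
    using bdd_measurable_integrable_on[OF rel_entropy_bdd_measurable[OF F1 F2 c(1,3)], of 0 1] by (intro integral_nonneg) auto
  then show ?thesis using G_fun_le_solution[OF assms] by linarith
qed

text \<open>Each solution beats the other by a relative entropy. Adding the two inequalities cancels
  the functional and leaves a nonpositive integral of a nonnegative continuous function.\<close>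

lemma bvp_unique:
  assumes c: "0 < \<alpha>" "\<alpha> < \<beta>" "\<beta> < 1" "A > 0" "B > 0" and \<gamma>: "\<gamma> \<in> M_ac"
    and s1: "solves_bvp \<alpha> \<beta> A B \<gamma> F1" and s2: "solves_bvp \<alpha> \<beta> A B \<gamma> F2"
  shows "F1 = F2"
proof -
  have F1: "F1 \<in> F_set \<alpha> \<beta>" and F2: "F2 \<in> F_set \<alpha> \<beta>" using s1 s2 by (auto simp: solves_bvp_def)
  let ?d = "\<lambda>x. (F1 x - F2 x) * (logit (F1 x) - logit (F2 x))"
  have r: "0 < F1 x" "F1 x < 1" "0 < F2 x" "F2 x < 1" if "x \<in> {0..1}" for x
    using F_set_range[OF F1 that] F_set_range[OF F2 that] c by auto
  note i = bdd_measurable_integrable_on[OF rel_entropy_bdd_measurable[OF F1 F2 c(1,3)], of 0 1, simplified]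
    bdd_measurable_integrable_on[OF rel_entropy_bdd_measurable[OF F2 F1 c(1,3)], of 0 1, simplified]
  have "integral {0..1} ?d = integral {0..1} (\<lambda>x. rel_entropy (F1 x) (F2 x)) + integral {0..1} (\<lambda>x. rel_entropy (F2 x) (F1 x))"
    unfolding rel_entropy_add_swap[symmetric] by (rule Henstock_Kurzweil_Integration.integral_add[OF i])
  also have "\<dots> \<le> 0"
    using G_fun_le_solution[OF c \<gamma> s1 F2] G_fun_le_solution[OF c \<gamma> s2 F1] by linarith
  finally have le: "integral {0..1} ?d \<le> 0" .
  have nn: "0 \<le> ?d x" if "x \<in> {0..1}" for x
    unfolding rel_entropy_add_swap[symmetric] using r[OF that] by (intro add_nonneg_nonneg rel_entropy_nonneg) auto
  have cont: "continuous_on {0..1} ?d"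
    unfolding logit_def
    by (intro continuous_intros F_set_continuous_ln[OF F1 c(1,3)] F_set_continuous_ln[OF F2 c(1,3)]
        F_set_continuous[OF F1] F_set_continuous[OF F2])
  have "integral {0..1} ?d \<ge> 0"
    by (intro integral_nonneg integrable_continuous_real cont nn)
  with le have "integral {0..1} ?d = 0" by simp
  then have z: "?d x = 0" if "x \<in> {0..1}" for x
    using integral_eq_0_iff[OF cont] nn that by auto
  show ?thesis
  proof (rule extensionalityI)
    show "F1 \<in> extensional {0..1}" "F2 \<in> extensional {0..1}" using F1 F2 by (auto simp: F_set_def)
    fix x :: real assume x: "x \<in> {0..1}"
    show "F1 x = F2 x"
      using z[OF x] r[OF x] logit_less[of "F1 x" "F2 x"] logit_less[of "F2 x" "F1 x"]
      by (cases "F1 x" "F2 x" rule: linorder_cases) auto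
  qed
qed

section \<open>Boundedness, convexity and lower semicontinuity\<close>

lemma rho_bar_bounds:
  assumes c: "\<alpha> < \<beta>" "A > 0" "B > 0" and x: "x \<in> {0..1}"
  shows "\<alpha> < rho_bar \<alpha> \<beta> A B x" "rho_bar \<alpha> \<beta> A B x < \<beta>"
proof -
  define D where "D = 1 + A + B"
  have D: "D > 0" using c by (simp add: D_def)
  have r: "rho_bar \<alpha> \<beta> A B x * D = \<alpha> * (1 + B) + \<beta> * A + (\<beta> - \<alpha>) * x"
    using D unfolding rho_bar_def D_def[symmetric] add_divide_distrib[symmetric] by simp
  have l: "(rho_bar \<alpha> \<beta> A B x - \<alpha>) * D = (\<beta> - \<alpha>) * (A + x)"
    by (simp only: left_diff_distrib r) (simp add: D_def algebra_simps)
  have "(rho_bar \<alpha> \<beta> A B x - \<alpha>) * D > 0" unfolding l using c x by (intro mult_pos_pos) auto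
  from zero_less_mult_pos2[OF this D] show "\<alpha> < rho_bar \<alpha> \<beta> A B x" by simp
  have u: "(\<beta> - rho_bar \<alpha> \<beta> A B x) * D = (\<beta> - \<alpha>) * (B + (1 - x))"
    by (simp only: left_diff_distrib r) (simp add: D_def algebra_simps)
  have "(\<beta> - rho_bar \<alpha> \<beta> A B x) * D > 0" unfolding u using c x by (intro mult_pos_pos) auto
  from zero_less_mult_pos2[OF this D] show "rho_bar \<alpha> \<beta> A B x < \<beta>" by simp
qed

lemma rho_bar_M_ac:
  assumes "0 < \<alpha>" "\<alpha> < \<beta>" "\<beta> < 1" "A > 0" "B > 0"
  shows "rho_bar \<alpha> \<beta> A B \<in> M_ac"
proof -
  have "continuous_on {0..1} (rho_bar \<alpha> \<beta> A B)"
    unfolding rho_bar_def using assms by (intro continuous_intros) auto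
  then have "rho_bar \<alpha> \<beta> A B \<in> borel_measurable (restrict_space borel {0..1})"
    by (rule borel_measurable_continuous_on_restrict)
  moreover have "0 \<le> rho_bar \<alpha> \<beta> A B x \<and> rho_bar \<alpha> \<beta> A B x \<le> 1" if "x \<in> {0..1}" for x
    using rho_bar_bounds[OF assms(2,4,5) that] assms(1,3) by linarith
  ultimately show ?thesis by (simp add: M_ac_def)
qed

lemma rho_bar_F_set:
  assumes "\<alpha> < \<beta>" "A > 0" "B > 0"
  defines "F \<equiv> restrict (rho_bar \<alpha> \<beta> A B) {0..1}"
  shows "F \<in> F_set \<alpha> \<beta>" "\<And>x. x \<in> {0..1} \<Longrightarrow> nabla F x = (\<beta> - \<alpha>) / (1 + A + B)"
proof -
  have d: "(F has_real_derivative (\<beta> - \<alpha>) / (1 + A + B)) (at x within {0..1})"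
    if x: "x \<in> {0..1}" for x
  proof -
    have "(rho_bar \<alpha> \<beta> A B has_real_derivative (\<beta> - \<alpha>) / (1 + A + B)) (at x within {0..1})"
      unfolding rho_bar_def using assms(1-3) by (auto intro!: derivative_eq_intros)
    then show ?thesis
      by (rule has_field_derivative_transform_within[where d = 1]) (use x in \<open>auto simp: F_def\<close>)
  qed
  show n: "nabla F x = (\<beta> - \<alpha>) / (1 + A + B)" if "x \<in> {0..1}" for x
    by (rule nabla_eqI[OF d[OF that] that])
  have "continuous_on {0..1} (nabla F)"
    by (rule continuous_on_eq[OF continuous_on_const]) (simp add: n)
  moreover have "F differentiable_on {0..1}"
    using d unfolding differentiable_on_def real_differentiable_def by blast
  ultimately show "F \<in> F_set \<alpha> \<beta>"
    using rho_bar_bounds[OF assms(1-3)] n assms(1-3) by (auto simp: F_set_def F_def)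
qed

text \<open>Only \<open>ln (nabla F)\<close> lacks a pointwise upper bound. Applying
  \<open>ln s \<le> s - 1\<close> to \<open>nabla F / (\<beta> - \<alpha>)\<close> makes its
  contribution at most \<open>(F 1 - F 0) / (\<beta> - \<alpha>) - 1 \<le> 0\<close>.\<close>

lemma G_fun_upper_bound:
  assumes c: "0 < \<alpha>" "\<alpha> < \<beta>" "\<beta> < 1" "A > 0" "B > 0" and \<gamma>: "\<gamma> \<in> M_ac" and F: "F \<in> F_set \<alpha> \<beta>"
  shows "G_fun \<alpha> \<beta> A B \<gamma> F \<le> - ln \<alpha> - ln (1 - \<beta>)
    + A * (ln (\<beta> - \<alpha>) - ln (A * (\<beta> - \<alpha>))) + B * (ln (\<beta> - \<alpha>) - ln (B * (\<beta> - \<alpha>)))"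
proof -
  have i: "nabla F integrable_on {0..1}" "integral {0..1} (nabla F) = F 1 - F 0"
    using primitive_diff[OF F_set_primitive[OF F], of 0 1] by (auto intro: integral_unique)
  have "integral {0..1} (G_integrand \<alpha> \<beta> \<gamma> F) \<le> (F 1 - F 0) * (1 / (\<beta> - \<alpha>)) + (- ln \<alpha> - ln (1 - \<beta>) - 1)"
  proof (rule has_integral_le[OF integrable_integral])
    show "G_integrand \<alpha> \<beta> \<gamma> F integrable_on {0..1}"
      by (rule bdd_measurable_integrable_on[OF G_integrand_bdd_measurable[OF \<gamma> F c(1,3)]]) auto
    have "((\<lambda>x. nabla F x * (1 / (\<beta> - \<alpha>)) + (- ln \<alpha> - ln (1 - \<beta>) - 1)) has_integral
        (F 1 - F 0) * (1 / (\<beta> - \<alpha>)) + (1 - 0) *\<^sub>R (- ln \<alpha> - ln (1 - \<beta>) - 1)) {0..1}"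
      using has_integral_const_real[of "- ln \<alpha> - ln (1 - \<beta>) - 1" 0 "1::real"]
      by (intro has_integral_add has_integral_mult_left primitive_diff[OF F_set_primitive[OF F]]) auto
    then show "((\<lambda>x. nabla F x * (1 / (\<beta> - \<alpha>)) + (- ln \<alpha> - ln (1 - \<beta>) - 1)) has_integral
        (F 1 - F 0) * (1 / (\<beta> - \<alpha>)) + (- ln \<alpha> - ln (1 - \<beta>) - 1)) {0..1}" by simp
    fix x :: real assume x: "x \<in> {0..1}"
    note r = F_set_range[OF F x] and g = M_ac_range[OF \<gamma> x]
    have "\<gamma> x * - ln (F x) \<le> 1 * - ln \<alpha>" "(1 - \<gamma> x) * - ln (1 - F x) \<le> 1 * - ln (1 - \<beta>)"
      using r g c by (intro mult_mono; simp)+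
    moreover have "ln (nabla F x) - ln (\<beta> - \<alpha>) \<le> nabla F x * (1 / (\<beta> - \<alpha>)) - 1"
      using ln_le_minus_one[of "nabla F x / (\<beta> - \<alpha>)"] r c by (simp add: ln_div)
    moreover have "neg_entropy (\<gamma> x) \<le> 0" using g by (intro neg_entropy_nonpos) auto
    ultimately show "G_integrand \<alpha> \<beta> \<gamma> F x \<le> nabla F x * (1 / (\<beta> - \<alpha>)) + (- ln \<alpha> - ln (1 - \<beta>) - 1)"
      by (simp add: G_integrand_def)
  qed
  moreover have "(F 1 - F 0) * (1 / (\<beta> - \<alpha>)) \<le> 1"
    using F_set_range[OF F, of 0] F_set_range[OF F, of 1] c by (simp add: pos_divide_le_eq)
  moreover have "A * (ln (F 0 - \<alpha>) - ln (A * (\<beta> - \<alpha>))) \<le> A * (ln (\<beta> - \<alpha>) - ln (A * (\<beta> - \<alpha>)))"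
    "B * (ln (\<beta> - F 1) - ln (B * (\<beta> - \<alpha>))) \<le> B * (ln (\<beta> - \<alpha>) - ln (B * (\<beta> - \<alpha>)))"
    using F_set_range[OF F, of 0] F_set_range[OF F, of 1] c by (auto intro!: mult_left_mono)
  ultimately show ?thesis unfolding G_fun_eq[OF \<gamma> F c] by linarith
qed

text \<open>One fixed competitor bounds the supremum from below for all \<gamma> at once. The linear
  profile has a constant derivative, so every term is explicit.\<close>

lemma G_fun_rho_bar_lower_bound:
  assumes c: "0 < \<alpha>" "\<alpha> < \<beta>" "\<beta> < 1" "A > 0" "B > 0" and \<gamma>: "\<gamma> \<in> M_ac"
  defines "F \<equiv> restrict (rho_bar \<alpha> \<beta> A B) {0..1}"
  shows "- 1 + (ln ((\<beta> - \<alpha>) / (1 + A + B)) - ln (\<beta> - \<alpha>))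
    + A * (ln (F 0 - \<alpha>) - ln (A * (\<beta> - \<alpha>))) + B * (ln (\<beta> - F 1) - ln (B * (\<beta> - \<alpha>)))
    \<le> G_fun \<alpha> \<beta> A B \<gamma> F"
proof -
  note F = rho_bar_F_set[OF c(2,4,5), folded F_def]
  let ?k = "- 1 + (ln ((\<beta> - \<alpha>) / (1 + A + B)) - ln (\<beta> - \<alpha>))"
  have "?k * (1 - 0) \<le> integral {0..1} (G_integrand \<alpha> \<beta> \<gamma> F)"
  proof (rule has_integral_le[OF _ integrable_integral])
    show "((\<lambda>x. ?k) has_integral ?k * (1 - 0)) {0..1::real}"
      using has_integral_const_real[of ?k 0 "1::real"] by simp
    show "G_integrand \<alpha> \<beta> \<gamma> F integrable_on {0..1}"
      by (rule bdd_measurable_integrable_on[OF G_integrand_bdd_measurable[OF \<gamma> F(1) c(1,3)]]) auto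
    fix x :: real assume x: "x \<in> {0..1}"
    have r: "0 < F x" "F x < 1" using F_set_range[OF F(1) x] c by auto
    note g = M_ac_range[OF \<gamma> x]
    have "\<gamma> x * ln (F x) \<le> 0" "(1 - \<gamma> x) * ln (1 - F x) \<le> 0"
      using g r by (auto intro!: mult_nonneg_nonpos)
    moreover have "- 1 \<le> neg_entropy (\<gamma> x)" using g by (intro neg_entropy_ge) auto
    ultimately show "?k \<le> G_integrand \<alpha> \<beta> \<gamma> F x"
      by (simp add: G_integrand_def F(2)[OF x])
  qed
  then show ?thesis unfolding G_fun_eq[OF \<gamma> F(1) c] by simp
qed

section \<open>Convexity in the density\<close>

lemma mult_ln_convex:
  fixes x y :: real
  assumes "0 \<le> x" "0 \<le> y" "0 \<le> t" "t \<le> 1"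
  shows "(t * x + (1 - t) * y) * ln (t * x + (1 - t) * y) \<le> t * (x * ln x) + (1 - t) * (y * ln y)"
proof -
  define z where "z = t * x + (1 - t) * y"
  show ?thesis
  proof (cases "z = 0")
    case True
    then have "t * x = 0" "(1 - t) * y = 0"
      using assms by (auto simp: z_def add_nonneg_eq_0_iff)
    then show ?thesis by (auto simp: mult.assoc[symmetric])
  next
    case False
    then have z: "z > 0" using assms unfolding z_def by (simp add: less_le)
    \<comment> \<open>Tangents at the mean \<open>z\<close>: their weighted right-hand sides
      cancel.\<close>
    have "t * (x * (ln z - ln x)) + (1 - t) * (y * (ln z - ln y)) \<le> t * (z - x) + (1 - t) * (z - y)"
      using assms z by (intro add_mono mult_left_mono mult_ln_diff_le) auto
    also have "\<dots> = 0" by (simp add: z_def algebra_simps)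
    finally have "(t * x + (1 - t) * y) * ln z \<le> t * (x * ln x) + (1 - t) * (y * ln y)"
      by (simp add: algebra_simps)
    then show ?thesis by (simp add: z_def)
  qed
qed

lemma neg_entropy_convex:
  assumes "0 \<le> x" "x \<le> 1" "0 \<le> y" "y \<le> 1" "0 \<le> t" "t \<le> 1"
  shows "neg_entropy (t * x + (1 - t) * y) \<le> t * neg_entropy x + (1 - t) * neg_entropy y"
proof -
  have "1 - (t * x + (1 - t) * y) = t * (1 - x) + (1 - t) * (1 - y)" by (simp add: algebra_simps)
  then show ?thesis
    using mult_ln_convex[of x y t] mult_ln_convex[of "1 - x" "1 - y" t] assms
    by (simp add: neg_entropy_def algebra_simps)
qed

lemma M_ac_convex:
  assumes "\<gamma> \<in> M_ac" "\<delta> \<in> M_ac" "t \<in> {0..1}"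
  shows "(\<lambda>x. t * \<gamma> x + (1 - t) * \<delta> x) \<in> M_ac"
proof -
  have [measurable]: "\<gamma> \<in> borel_measurable (restrict_space borel {0..1})"
    "\<delta> \<in> borel_measurable (restrict_space borel {0..1})"
    using assms by (simp_all add: M_ac_def)
  have "(\<lambda>x. t * \<gamma> x + (1 - t) * \<delta> x) \<in> borel_measurable (restrict_space borel {0..1})"
    by measurable
  moreover have "0 \<le> t * \<gamma> x + (1 - t) * \<delta> x" "t * \<gamma> x + (1 - t) * \<delta> x \<le> 1" if "x \<in> {0..1}" for x
    using M_ac_range[OF assms(1) that] M_ac_range[OF assms(2) that] assms(3)
    by (auto intro!: add_nonneg_nonneg mult_nonneg_nonneg convex_bound_le)
  ultimately show ?thesis by (simp add: M_ac_def)
qed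

text \<open>For fixed \<open>F\<close>, only the entropy of the density enters nonlinearly;
  everything else is affine in it.\<close>

lemma G_fun_convex:
  assumes c: "0 < \<alpha>" "\<alpha> < \<beta>" "\<beta> < 1" "A > 0" "B > 0"
    and \<gamma>: "\<gamma> \<in> M_ac" and \<delta>: "\<delta> \<in> M_ac" and t: "t \<in> {0..1}" and F: "F \<in> F_set \<alpha> \<beta>"
  shows "G_fun \<alpha> \<beta> A B (\<lambda>x. t * \<gamma> x + (1 - t) * \<delta> x) F
    \<le> t * G_fun \<alpha> \<beta> A B \<gamma> F + (1 - t) * G_fun \<alpha> \<beta> A B \<delta> F"
proof -
  let ?m = "\<lambda>x. t * \<gamma> x + (1 - t) * \<delta> x"
  note m = M_ac_convex[OF \<gamma> \<delta> t]
  note i = bdd_measurable_integrable_on[OF G_integrand_bdd_measurable[OF _ F c(1,3)], of _ 0 1, simplified]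
  have "integral {0..1} (G_integrand \<alpha> \<beta> ?m F)
      \<le> t * integral {0..1} (G_integrand \<alpha> \<beta> \<gamma> F) + (1 - t) * integral {0..1} (G_integrand \<alpha> \<beta> \<delta> F)"
  proof (rule has_integral_le[OF integrable_integral[OF i[OF m]]])
    show "((\<lambda>x. t * G_integrand \<alpha> \<beta> \<gamma> F x + (1 - t) * G_integrand \<alpha> \<beta> \<delta> F x) has_integral
        t * integral {0..1} (G_integrand \<alpha> \<beta> \<gamma> F) + (1 - t) * integral {0..1} (G_integrand \<alpha> \<beta> \<delta> F)) {0..1}"
      by (intro has_integral_add has_integral_mult_right integrable_integral i \<gamma> \<delta>)
    fix x :: real assume x: "x \<in> {0..1}"
    have "neg_entropy (?m x) \<le> t * neg_entropy (\<gamma> x) + (1 - t) * neg_entropy (\<delta> x)"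
      using M_ac_range[OF \<gamma> x] M_ac_range[OF \<delta> x] t by (intro neg_entropy_convex) auto
    then show "G_integrand \<alpha> \<beta> ?m F x \<le> t * G_integrand \<alpha> \<beta> \<gamma> F x + (1 - t) * G_integrand \<alpha> \<beta> \<delta> F x"
      unfolding G_integrand_def by (simp add: algebra_simps)
  qed
  then show ?thesis
    unfolding G_fun_eq[OF m F c] G_fun_eq[OF \<gamma> F c] G_fun_eq[OF \<delta> F c] by (simp add: algebra_simps)
qed

section \<open>Lower semicontinuity in the weak topology\<close>

lemma integral_density_measure:
  assumes \<gamma>: "\<gamma> \<in> M_ac" and f: "continuous_on {0..1} f"
  shows "(\<integral>x. f x \<partial>density_measure \<gamma>) = integral {0..1} (\<lambda>x. \<gamma> x * f x)"
proof -
  let ?L = "restrict_space lborel {0..1::real}"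
  have sets: "sets ?L = sets (restrict_space borel {0..1})" by (simp add: sets_restrict_space)
  have "\<gamma> \<in> borel_measurable ?L" "f \<in> borel_measurable ?L"
    using bdd_measurable_measurable[OF M_ac_bdd_measurable[OF \<gamma>]] bdd_measurable_measurable[OF bdd_measurable_continuous[OF f]]
      measurable_cong_sets[OF sets refl] by blast+
  then have "(\<integral>x. f x \<partial>density_measure \<gamma>) = (\<integral>x. \<gamma> x *\<^sub>R f x \<partial>?L)"
    unfolding density_measure_def using M_ac_range[OF \<gamma>]
    by (intro integral_density) (auto intro!: AE_I2 simp: space_restrict_space)
  also have "\<dots> = (LINT x:{0..1}|lborel. \<gamma> x * f x)"
    by (simp add: integral_restrict_space set_lebesgue_integral_def)
  also have "\<dots> = integral {0..1} (\<lambda>x. \<gamma> x * f x)"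
    by (rule bdd_measurable_LINT) (auto intro: bdd_measurable_mult M_ac_bdd_measurable \<gamma> bdd_measurable_continuous f)
  finally show ?thesis .
qed

lemma openin_M_ac_linear_functional:
  assumes f: "continuous_on {0..1} f"
  shows "openin M_ac_topology {\<gamma> \<in> M_ac. r < integral {0..1} (\<lambda>x. \<gamma> x * f x)}"
proof -
  let ?U = "{\<mu> \<in> unit_measures. (\<integral>x. f x \<partial>\<mu>) \<in> {r<..}}"
  have "openin weak_topology ?U"
    unfolding weak_topology_def
    by (intro topology_generated_by_Basis CollectI exI[of _ f] exI[of _ "{r<..}"] conjI refl f) simp
  moreover have "{\<gamma> \<in> M_ac. r < integral {0..1} (\<lambda>x. \<gamma> x * f x)} = density_measure -` ?U \<inter> M_ac"
    by (auto simp: integral_density_measure[OF _ f] density_measure_in_unit_measures)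
  ultimately show ?thesis
    unfolding M_ac_topology_def openin_pullback_topology by blast
qed

text \<open>If clipping moves \<open>g\<close>, one of the two terms becomes nonpositive and the
  other is at most \<open>- ln (1 - d)\<close>.\<close>

lemma rel_entropy_clip_le:
  assumes g: "0 \<le> g" "g \<le> 1" and d: "0 < d" "d \<le> 1 / 2"
  shows "rel_entropy g (max d (min (1 - d) g)) \<le> - ln (1 - d)"
proof -
  have le: "a * (ln a - ln b) \<le> 0" if "0 \<le> a" "a \<le> b" for a b :: real
    using that by (cases "a = 0") (auto intro!: mult_nonneg_nonpos)
  have ln1: "x * (ln x - ln (1 - d)) \<le> - ln (1 - d)" if "0 \<le> x" "x \<le> 1" for x
  proof -
    have "x * ln x \<le> 0" using le[of x 1] that by simp
    moreover have "x * - ln (1 - d) \<le> 1 * - ln (1 - d)" using that d by (intro mult_right_mono) auto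
    ultimately show ?thesis by (simp add: right_diff_distrib)
  qed
  consider "g < d" | "d \<le> g" "g \<le> 1 - d" | "1 - d < g" by linarith
  then show ?thesis
  proof cases
    case 1
    then have "max d (min (1 - d) g) = d" using d by auto
    then show ?thesis using le[of g d] ln1[of "1 - g"] g 1 by (simp add: rel_entropy_def)
  next
    case 2
    then have "max d (min (1 - d) g) = g" by auto
    moreover have "0 \<le> - ln (1 - d)" using d by simp
    ultimately show ?thesis by (simp add: rel_entropy_def)
  next
    case 3
    then have "max d (min (1 - d) g) = 1 - d" using d by auto
    then show ?thesis using le[of "1 - g" d] ln1[of g] g 3 by (simp add: rel_entropy_def)
  qed
qed

text \<open>By Gibbs' inequality the entropy is a supremum of weakly continuous affine functionals,
  indexed by continuous densities \<open>P\<close>; here the supremum is almost attained.\<close>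

lemma rel_entropy_approximation:
  assumes \<gamma>: "\<gamma> \<in> M_ac" and e: "e > 0"
  obtains P where "continuous_on {0..1} P" "\<And>x. x \<in> {0..1} \<Longrightarrow> 0 < P x \<and> P x < 1"
    "integral {0..1} (\<lambda>x. rel_entropy (\<gamma> x) (P x)) < e"
proof -
  \<comment> \<open>Chosen so that \<open>1 - d > exp (- e)\<close>, which makes the clipping error
    \<open>- ln (1 - d)\<close> smaller than \<open>e\<close>.\<close>
  define d where "d = min (1 / 2) ((1 - exp (- e)) / 2)"
  have d: "0 < d" "d \<le> 1 / 2" using e by (auto simp: d_def)
  have "exp (- e) < 1 - d"
  proof -
    have "d \<le> (1 - exp (- e)) / 2" by (simp add: d_def)
    then have "2 * d \<le> 1 - exp (- e)" by simp
    then show ?thesis using d(1) by linarith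
  qed
  then have "ln (exp (- e)) < ln (1 - d)" using d by (subst ln_less_cancel_iff) auto
  then have de: "- ln (1 - d) < e" by simp
  let ?q = "\<lambda>x. max d (min (1 - d) x)"
  have q: "d \<le> ?q x" "?q x \<le> 1 - d" for x using d by auto
  have "(\<lambda>x. indicator {0..1} x *\<^sub>R \<gamma> x) \<in> borel_measurable borel"
    using bdd_measurable_measurable[OF M_ac_bdd_measurable[OF \<gamma>]] by (simp add: borel_measurable_restrict_space_iff)
  then have "(\<lambda>x. indicator {0..1} x *\<^sub>R \<gamma> x) \<in> borel_measurable lebesgue"
    by (intro measurable_completion) simp
  then have "(\<lambda>x. indicator {0..1} x *\<^sub>R \<gamma> x) measurable_on UNIV"
    by (intro lebesgue_measurable_imp_measurable_on) auto
  \<comment> \<open>A measurable function is an almost everywhere limit of continuous ones. Clipping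
    these keeps them continuous and makes the relative entropies uniformly bounded by
    \<open>- 2 * ln d\<close>.\<close>
  then obtain N g where N: "negligible N" and g: "\<And>n. continuous_on UNIV (g n)"
    and lim: "\<And>x. x \<notin> N \<Longrightarrow> (\<lambda>n. g n x) \<longlonglongrightarrow> indicator {0..1} x *\<^sub>R \<gamma> x"
    unfolding measurable_on_def by auto
  have lim': "(\<lambda>n. g n x) \<longlonglongrightarrow> \<gamma> x" if "x \<in> {0..1}" "x \<notin> N" for x
    using lim[OF that(2)] that(1) by simp
  define P where "P n x = ?q (g n x)" for n x
  have Pc: "continuous_on {0..1} (P n)" for n
    unfolding P_def by (intro continuous_intros continuous_on_subset[OF g]) auto
  have Pr: "0 < P n x" "P n x < 1" "0 < 1 - P n x" "d \<le> P n x" "d \<le> 1 - P n x" for n x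
    using q[of "g n x"] d by (auto simp: P_def)
  have klb: "\<bar>rel_entropy (\<gamma> x) p\<bar> \<le> - 2 * ln d" if x: "x \<in> {0..1}" and p: "d \<le> p" "d \<le> 1 - p" for x p
  proof -
    note r = M_ac_range[OF \<gamma> x]
    have "rel_entropy (\<gamma> x) p = neg_entropy (\<gamma> x) + \<gamma> x * - ln p + (1 - \<gamma> x) * - ln (1 - p)"
      by (simp add: rel_entropy_def neg_entropy_def algebra_simps)
    also have "\<dots> \<le> 0 + 1 * - ln d + 1 * - ln d"
      using r p d by (intro add_mono mult_mono neg_entropy_nonpos) auto
    finally show ?thesis using rel_entropy_nonneg[of "\<gamma> x" p] r p d by simp
  qed
  have lnP: "continuous_on {0..1} (\<lambda>x. ln (P n x))" "continuous_on {0..1} (\<lambda>x. ln (1 - P n x))" for n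
    using Pr[of n] by (auto intro!: continuous_intros Pc simp: less_imp_neq[THEN not_sym])
  have klP: "bdd_measurable (\<lambda>x. rel_entropy (\<gamma> x) (P n x))" for n
  proof -
    have "bdd_measurable (\<lambda>x. neg_entropy (\<gamma> x) - (\<gamma> x * ln (P n x) + (1 - \<gamma> x) * ln (1 - P n x)))"
      by (intro bdd_measurable_intros neg_entropy_bdd_measurable \<gamma> M_ac_bdd_measurable bdd_measurable_continuous lnP)
    then show ?thesis by (rule bdd_measurable_cong) (simp add: rel_entropy_def neg_entropy_def algebra_simps)
  qed
  \<comment> \<open>Setting the integrands to zero on the null set \<open>N\<close> gives
    convergence at every point without changing the integrals over \<open>P n\<close>.\<close>
  define k where "k n x = (if x \<in> N then 0 else rel_entropy (\<gamma> x) (P n x))" for n x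
  define k0 where "k0 x = (if x \<in> N then 0 else rel_entropy (\<gamma> x) (?q (\<gamma> x)))" for x
  have ki: "k n integrable_on {0..1}" for n
    by (rule integrable_spike[OF bdd_measurable_integrable_on[OF klP, of 0 1] N]) (auto simp: k_def)
  have kI: "integral {0..1} (k n) = integral {0..1} (\<lambda>x. rel_entropy (\<gamma> x) (P n x))" for n
    by (rule integral_spike[OF N]) (auto simp: k_def)
  have kb: "norm (k n x) \<le> - 2 * ln d" if "x \<in> {0..1}" for n x
    using klb[OF that, of "P n x"] Pr[of n x] d by (auto simp: k_def)
  have rel_entropy: "(\<lambda>n. k n x) \<longlonglongrightarrow> k0 x" if x: "x \<in> {0..1}" for x
  proof (cases "x \<in> N")
    case False
    have "(\<lambda>n. P n x) \<longlonglongrightarrow> ?q (\<gamma> x)"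
      unfolding P_def by (intro tendsto_intros lim' x False)
    then have "(\<lambda>n. rel_entropy (\<gamma> x) (P n x)) \<longlonglongrightarrow> rel_entropy (\<gamma> x) (?q (\<gamma> x))"
      unfolding rel_entropy_def using q[of "\<gamma> x"] d by (intro tendsto_intros) auto
    then show ?thesis using False by (simp add: k_def k0_def)
  qed (simp add: k_def k0_def)
  have dom: "k0 integrable_on {0..1}" "(\<lambda>n. integral {0..1} (k n)) \<longlonglongrightarrow> integral {0..1} k0"
    using dominated_convergence[of k "{0..1}" "\<lambda>_. - 2 * ln d" k0, OF ki _ kb rel_entropy] by auto
  have "integral {0..1} k0 \<le> - ln (1 - d) * (1 - 0)"
  proof (rule has_integral_le[OF integrable_integral[OF dom(1)]])
    show "((\<lambda>x. - ln (1 - d)) has_integral - ln (1 - d) * (1 - 0)) {0..1::real}"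
      using has_integral_const_real[of "- ln (1 - d)" 0 "1::real"] by simp
    show "k0 x \<le> - ln (1 - d)" if "x \<in> {0..1}" for x
      using rel_entropy_clip_le[of "\<gamma> x" d] M_ac_range[OF \<gamma> that] d by (simp add: k0_def)
  qed
  then have "integral {0..1} k0 < e" using de by simp
  then obtain n where "integral {0..1} (k n) < e"
    using order_tendstoD(2)[OF dom(2)] eventually_sequentially by (metis order_refl)
  then show thesis using that[of "P n"] Pc Pr by (simp add: kI)
qed

lemma G_fun_lower_semicontinuous:
  assumes c: "0 < \<alpha>" "\<alpha> < \<beta>" "\<beta> < 1" "A > 0" "B > 0"
    and \<gamma>: "\<gamma> \<in> M_ac" and F: "F \<in> F_set \<alpha> \<beta>" and r: "r < G_fun \<alpha> \<beta> A B \<gamma> F"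
  obtains T where "openin M_ac_topology T" "\<gamma> \<in> T" "\<And>\<delta>. \<delta> \<in> T \<Longrightarrow> \<delta> \<in> M_ac \<and> r < G_fun \<alpha> \<beta> A B \<delta> F"
proof -
  obtain P where P: "continuous_on {0..1} P" "\<And>x. x \<in> {0..1} \<Longrightarrow> 0 < P x \<and> P x < 1"
    "integral {0..1} (\<lambda>x. rel_entropy (\<gamma> x) (P x)) < G_fun \<alpha> \<beta> A B \<gamma> F - r"
    using rel_entropy_approximation[OF \<gamma>, of "G_fun \<alpha> \<beta> A B \<gamma> F - r"] r by auto
  have lnP: "continuous_on {0..1} (\<lambda>x. ln (P x))" "continuous_on {0..1} (\<lambda>x. ln (1 - P x))"
    using P(2) by (auto intro!: continuous_intros P(1) simp: less_imp_neq[THEN not_sym])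
  note lnF = F_set_continuous_ln[OF F c(1,3)]
  define f where "f x = logit (P x) - logit (F x)" for x
  define u where "u x = ln (1 - P x) - ln (1 - F x) + (ln (nabla F x) - ln (\<beta> - \<alpha>))" for x
  define K where "K = integral {0..1} u + A * (ln (F 0 - \<alpha>) - ln (A * (\<beta> - \<alpha>))) + B * (ln (\<beta> - F 1) - ln (B * (\<beta> - \<alpha>)))"
  have fc: "continuous_on {0..1} f" unfolding f_def logit_def by (intro continuous_intros lnP lnF)
  have uc: "continuous_on {0..1} u" unfolding u_def by (intro continuous_intros lnP lnF)
  have klb: "bdd_measurable (\<lambda>x. rel_entropy (\<delta> x) (P x))" if \<delta>: "\<delta> \<in> M_ac" for \<delta>
  proof -
    have "bdd_measurable (\<lambda>x. neg_entropy (\<delta> x) - (\<delta> x * ln (P x) + (1 - \<delta> x) * ln (1 - P x)))"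
      by (intro bdd_measurable_intros neg_entropy_bdd_measurable \<delta> M_ac_bdd_measurable bdd_measurable_continuous lnP)
    then show ?thesis by (rule bdd_measurable_cong) (simp add: rel_entropy_def neg_entropy_def algebra_simps)
  qed
  have eq: "G_fun \<alpha> \<beta> A B \<delta> F = integral {0..1} (\<lambda>x. rel_entropy (\<delta> x) (P x)) + integral {0..1} (\<lambda>x. \<delta> x * f x) + K"
    if \<delta>: "\<delta> \<in> M_ac" for \<delta>
  proof -
    note ib = bdd_measurable_integrable_on[of _ 0 1, simplified]
    have "((\<lambda>x. rel_entropy (\<delta> x) (P x) + \<delta> x * f x + u x) has_integral
        integral {0..1} (\<lambda>x. rel_entropy (\<delta> x) (P x)) + integral {0..1} (\<lambda>x. \<delta> x * f x) + integral {0..1} u) {0..1}"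
      by (intro has_integral_add integrable_integral ib klb \<delta> bdd_measurable_mult M_ac_bdd_measurable bdd_measurable_continuous fc uc)
    moreover have "rel_entropy (\<delta> x) (P x) + \<delta> x * f x + u x = G_integrand \<alpha> \<beta> \<delta> F x" for x
      by (simp add: rel_entropy_def f_def u_def G_integrand_def neg_entropy_def logit_def algebra_simps)
    ultimately have "integral {0..1} (G_integrand \<alpha> \<beta> \<delta> F)
        = integral {0..1} (\<lambda>x. rel_entropy (\<delta> x) (P x)) + integral {0..1} (\<lambda>x. \<delta> x * f x) + integral {0..1} u"
      by (simp add: integral_unique)
    then show ?thesis unfolding G_fun_eq[OF \<delta> F c] K_def by simp
  qed
  show thesis
  proof (rule that)
    show "openin M_ac_topology {\<delta> \<in> M_ac. r - K < integral {0..1} (\<lambda>x. \<delta> x * f x)}"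
      by (rule openin_M_ac_linear_functional[OF fc])
    show "\<gamma> \<in> {\<delta> \<in> M_ac. r - K < integral {0..1} (\<lambda>x. \<delta> x * f x)}"
      using eq[OF \<gamma>] P(3) \<gamma> by auto
    fix \<delta> assume "\<delta> \<in> {\<delta> \<in> M_ac. r - K < integral {0..1} (\<lambda>x. \<delta> x * f x)}"
    then have \<delta>: "\<delta> \<in> M_ac" and lt: "r - K < integral {0..1} (\<lambda>x. \<delta> x * f x)" by auto
    have "0 \<le> rel_entropy (\<delta> x) (P x)" if "x \<in> {0..1}" for x
      using M_ac_range[OF \<delta> that] P(2)[OF that] by (intro rel_entropy_nonneg) auto
    then have "0 \<le> integral {0..1} (\<lambda>x. rel_entropy (\<delta> x) (P x))"
      using bdd_measurable_integrable_on[OF klb[OF \<delta>], of 0 1] by (intro integral_nonneg) auto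
    then show "\<delta> \<in> M_ac \<and> r < G_fun \<alpha> \<beta> A B \<delta> F" using eq[OF \<delta>] lt \<delta> by simp
  qed
qed

theorem theorem2p4:
  fixes \<alpha> \<beta> A B :: real
  assumes "0 < \<alpha>" and "\<alpha> < \<beta>" and "\<beta> < 1" and "A > 0" and "B > 0"
  shows "(\<exists>C::real. \<forall>\<gamma>\<in>M_ac. \<bar>S_fun \<alpha> \<beta> A B \<gamma>\<bar> \<le> ereal C)
    \<and> (\<forall>\<gamma>\<in>M_ac. \<forall>\<delta>\<in>M_ac. \<forall>t\<in>{0..1}.
         (\<lambda>x. t * \<gamma> x + (1 - t) * \<delta> x) \<in> M_ac \<and>
         S_fun \<alpha> \<beta> A B (\<lambda>x. t * \<gamma> x + (1 - t) * \<delta> x)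
           \<le> ereal t * S_fun \<alpha> \<beta> A B \<gamma> + ereal (1 - t) * S_fun \<alpha> \<beta> A B \<delta>)
    \<and> lower_semicontinuous_map M_ac_topology (S_fun \<alpha> \<beta> A B)
    \<and> (\<forall>\<gamma>\<in>M_ac. (\<exists>!F. solves_bvp \<alpha> \<beta> A B \<gamma> F) \<and>
         S0 \<alpha> \<beta> A B \<gamma> = ereal (G_fun \<alpha> \<beta> A B \<gamma> (F_sol \<alpha> \<beta> A B \<gamma>)))"
proof -
  note c = assms
  have ex1: "\<exists>!F. solves_bvp \<alpha> \<beta> A B \<gamma> F" if "\<gamma> \<in> M_ac" for \<gamma>
    using bvp_exists[OF c that] bvp_unique[OF c that] by blast
  have sol: "solves_bvp \<alpha> \<beta> A B \<gamma> (F_sol \<alpha> \<beta> A B \<gamma>)" if "\<gamma> \<in> M_ac" for \<gamma>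
    unfolding F_sol_def by (rule theI'[OF ex1[OF that]])
  have Fs: "F_sol \<alpha> \<beta> A B \<gamma> \<in> F_set \<alpha> \<beta>" if "\<gamma> \<in> M_ac" for \<gamma>
    using sol[OF that] by (simp add: solves_bvp_def)
  define s where "s \<gamma> = G_fun \<alpha> \<beta> A B \<gamma> (F_sol \<alpha> \<beta> A B \<gamma>)" for \<gamma>
  have le: "G_fun \<alpha> \<beta> A B \<gamma> F \<le> s \<gamma>" if "\<gamma> \<in> M_ac" "F \<in> F_set \<alpha> \<beta>" for \<gamma> F
    unfolding s_def by (rule G_fun_le[OF c that(1) sol[OF that(1)] that(2)])
  have S0: "S0 \<alpha> \<beta> A B \<gamma> = ereal (s \<gamma>)" if "\<gamma> \<in> M_ac" for \<gamma>
    unfolding S0_def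
  proof (rule antisym)
    show "(SUP F\<in>F_set \<alpha> \<beta>. ereal (G_fun \<alpha> \<beta> A B \<gamma> F)) \<le> ereal (s \<gamma>)"
      using le[OF that] by (intro SUP_least) auto
    show "ereal (s \<gamma>) \<le> (SUP F\<in>F_set \<alpha> \<beta>. ereal (G_fun \<alpha> \<beta> A B \<gamma> F))"
      unfolding s_def by (rule SUP_upper[OF Fs[OF that]])
  qed
  define z where "z = s (rho_bar \<alpha> \<beta> A B)"
  \<comment> \<open>Both values of \<open>S0\<close> are finite, so the subtraction in the extended
    reals is an ordinary one.\<close>
  have S: "S_fun \<alpha> \<beta> A B \<gamma> = ereal (s \<gamma> - z)" if "\<gamma> \<in> M_ac" for \<gamma>
    using S0[OF that] S0[OF rho_bar_M_ac[OF c]] by (simp add: S_fun_def z_def)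
  obtain u l where u: "\<And>\<gamma>. \<gamma> \<in> M_ac \<Longrightarrow> s \<gamma> \<le> u" and l: "\<And>\<gamma>. \<gamma> \<in> M_ac \<Longrightarrow> l \<le> s \<gamma>"
  proof
    show "s \<gamma> \<le> - ln \<alpha> - ln (1 - \<beta>)
        + A * (ln (\<beta> - \<alpha>) - ln (A * (\<beta> - \<alpha>))) + B * (ln (\<beta> - \<alpha>) - ln (B * (\<beta> - \<alpha>)))"
      if "\<gamma> \<in> M_ac" for \<gamma>
      unfolding s_def by (rule G_fun_upper_bound[OF c that Fs[OF that]])
    show "- 1 + (ln ((\<beta> - \<alpha>) / (1 + A + B)) - ln (\<beta> - \<alpha>))
        + A * (ln (restrict (rho_bar \<alpha> \<beta> A B) {0..1} 0 - \<alpha>) - ln (A * (\<beta> - \<alpha>)))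
        + B * (ln (\<beta> - restrict (rho_bar \<alpha> \<beta> A B) {0..1} 1) - ln (B * (\<beta> - \<alpha>))) \<le> s \<gamma>"
      if "\<gamma> \<in> M_ac" for \<gamma>
      using G_fun_rho_bar_lower_bound[OF c that] le[OF that rho_bar_F_set(1)[OF c(2,4,5)]]
      by (rule order_trans)
  qed
  have "\<bar>S_fun \<alpha> \<beta> A B \<gamma>\<bar> \<le> ereal (u - l)" if "\<gamma> \<in> M_ac" for \<gamma>
    using u[OF that] l[OF that] u[OF rho_bar_M_ac[OF c]] l[OF rho_bar_M_ac[OF c]]
    by (simp add: S[OF that] z_def)
  then have bounded: "\<exists>C::real. \<forall>\<gamma>\<in>M_ac. \<bar>S_fun \<alpha> \<beta> A B \<gamma>\<bar> \<le> ereal C" by blast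
  have convex: "(\<lambda>x. t * \<gamma> x + (1 - t) * \<delta> x) \<in> M_ac \<and>
         S_fun \<alpha> \<beta> A B (\<lambda>x. t * \<gamma> x + (1 - t) * \<delta> x)
           \<le> ereal t * S_fun \<alpha> \<beta> A B \<gamma> + ereal (1 - t) * S_fun \<alpha> \<beta> A B \<delta>"
    if \<gamma>: "\<gamma> \<in> M_ac" and \<delta>: "\<delta> \<in> M_ac" and t: "t \<in> {0..1}" for \<gamma> \<delta> t
  proof
    let ?m = "\<lambda>x. t * \<gamma> x + (1 - t) * \<delta> x"
    show m: "?m \<in> M_ac" by (rule M_ac_convex[OF \<gamma> \<delta> t])
    \<comment> \<open>The maximiser for the mixture serves as a competitor for both
      densities.\<close>
    have "s ?m \<le> t * G_fun \<alpha> \<beta> A B \<gamma> (F_sol \<alpha> \<beta> A B ?m) + (1 - t) * G_fun \<alpha> \<beta> A B \<delta> (F_sol \<alpha> \<beta> A B ?m)"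
      unfolding s_def by (rule G_fun_convex[OF c \<gamma> \<delta> t Fs[OF m]])
    also have "\<dots> \<le> t * s \<gamma> + (1 - t) * s \<delta>"
      using t by (intro add_mono mult_left_mono le \<gamma> \<delta> Fs m) auto
    finally show "S_fun \<alpha> \<beta> A B ?m \<le> ereal t * S_fun \<alpha> \<beta> A B \<gamma> + ereal (1 - t) * S_fun \<alpha> \<beta> A B \<delta>"
      unfolding S[OF m] S[OF \<gamma>] S[OF \<delta>] by (simp add: algebra_simps)
  qed
  have lsc: "lower_semicontinuous_map M_ac_topology (S_fun \<alpha> \<beta> A B)"
    unfolding lower_semicontinuous_map_def topspace_M_ac_topology
  proof
    fix a
    show "openin M_ac_topology {\<gamma> \<in> M_ac. a < S_fun \<alpha> \<beta> A B \<gamma>}"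
    proof (subst openin_subopen, intro ballI)
      fix \<gamma> assume "\<gamma> \<in> {\<gamma> \<in> M_ac. a < S_fun \<alpha> \<beta> A B \<gamma>}"
      then have \<gamma>: "\<gamma> \<in> M_ac" and "a < ereal (s \<gamma> - z)" using S by auto
      then obtain r where r: "a < ereal r" "r < s \<gamma> - z" using ereal_dense2 by fastforce
      \<comment> \<open>The maximiser for \<gamma> is kept fixed, and is only a competitor for the
        nearby densities \<delta>.\<close>
      then have "r + z < G_fun \<alpha> \<beta> A B \<gamma> (F_sol \<alpha> \<beta> A B \<gamma>)" by (simp add: s_def)
      then obtain T where T: "openin M_ac_topology T" "\<gamma> \<in> T"
        "\<And>\<delta>. \<delta> \<in> T \<Longrightarrow> \<delta> \<in> M_ac \<and> r + z < G_fun \<alpha> \<beta> A B \<delta> (F_sol \<alpha> \<beta> A B \<gamma>)"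
        using G_fun_lower_semicontinuous[OF c \<gamma> Fs[OF \<gamma>]] by blast
      have "a < S_fun \<alpha> \<beta> A B \<delta>" if "\<delta> \<in> T" for \<delta>
      proof -
        have "ereal r < ereal (s \<delta> - z)"
          using T(3)[OF that] le[of \<delta> "F_sol \<alpha> \<beta> A B \<gamma>"] Fs[OF \<gamma>] by auto
        then show ?thesis using r(1) T(3)[OF that] S by (metis less_trans)
      qed
      then show "\<exists>T. openin M_ac_topology T \<and> \<gamma> \<in> T \<and> T \<subseteq> {\<gamma> \<in> M_ac. a < S_fun \<alpha> \<beta> A B \<gamma>}"
        using T by blast
    qed
  qed
  show ?thesis
    using bounded convex lsc ex1 S0 unfolding s_def by blast
qed

end
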